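(* There is a polynomial time reduction which, given a tuple $(A_1,\dots,A_n)$ of positive semidefinite $n\times n$ matrices, outputs a positive semidefinite matrix $L\in\mathbb{R}^{m\times m}$, a cost vector $c\in\mathbb{Z}^m$ and a cost value $C\in\mathbb{Z}$ such that $$\alpha\cdot D(A_1,A_2,\dots,A_n)=\sum_{S\subseteq[m],\ c(S)=C}\mu(S),$$ where $\mu(S)=\det(L_{S,S})$ for $S\subseteq[m]$, and $\alpha$ is an efficiently computable scalar. Moreover, $\|c\|_1\le 2^{O(n\log n)}$.
   Context: $[m]=\{1,\dots,m\}$; $c(S)=\sum_{i\in S}c_i$ and $\|c\|_1=\sum_i|c_i|$. $L_{S,S}$ is the submatrix of $L$ with rows and columns indexed by $S$. Positive semidefinite matrices are real symmetric. For symmetric $A_1,\dots,A_n\in\mathbb{R}^{n\times n}$ the mixed discriminant is $D(A_1,\dots,A_n)=\frac{\partial^n}{\partial z_1\cdots\partial z_n}\det(z_1A_1+\dots+z_nA_n)$. *)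

theory Defs
  imports
    "HOL-Analysis.Derivative"
    "HOL-Library.Landau_Symbols"
    "HOL-Library.Log_Nat"
    "HOL-Computational_Algebra.Polynomial"
    "Jordan_Normal_Form.Determinant"
    "Jordan_Normal_Form.DL_Submatrix"
begin

unbundle no vec_syntax

section \<open>Matrices\<close>

text \<open>Rows, columns and the ground set \<open>[m]\<close> are indexed from 0, as in the matrix library.\<close>

definition psd :: "nat \<Rightarrow> real mat \<Rightarrow> bool" where
  "psd n A \<longleftrightarrow> A \<in> carrier_mat n n \<and> transpose_mat A = A \<and>
     (\<forall>x \<in> carrier_vec n. 0 \<le> scalar_prod x (A *\<^sub>v x))"

definition partial_deriv :: "nat \<Rightarrow> ((nat \<Rightarrow> real) \<Rightarrow> real) \<Rightarrow> (nat \<Rightarrow> real) \<Rightarrow> real" where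
  "partial_deriv i F = (\<lambda>z. deriv (\<lambda>t. F (z(i := t))) (z i))"

definition pencil :: "nat \<Rightarrow> (nat \<Rightarrow> real mat) \<Rightarrow> (nat \<Rightarrow> real) \<Rightarrow> real mat" where
  "pencil n A z = mat n n (\<lambda>(j, k). \<Sum>i<n. z i * A i $$ (j, k))"

text \<open>The determinant of the pencil is homogeneous of degree \<open>n\<close> in the \<open>n\<close> variables, so its
  \<open>n\<close>-th order mixed derivative is constant; it is read off at the origin.\<close>

definition mixed_discriminant :: "nat \<Rightarrow> (nat \<Rightarrow> real mat) \<Rightarrow> real" where
  "mixed_discriminant n A =
     foldr partial_deriv [0..<n] (\<lambda>z. Determinant.det (pencil n A z)) (\<lambda>_. 0)"

definition dpp_weight :: "real mat \<Rightarrow> nat set \<Rightarrow> real" where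
  "dpp_weight L S = Determinant.det (submatrix L S S)"

definition cost :: "int vec \<Rightarrow> nat set \<Rightarrow> int" where
  "cost c S = (\<Sum>i\<in>S. c $ i)"

definition l1_norm :: "int vec \<Rightarrow> int" where
  "l1_norm c = (\<Sum>i<dim_vec c. \<bar>c $ i\<bar>)"


section \<open>Machine model\<close>

text \<open>A structured real random access machine.  Index variables hold natural numbers and admit
  only addition and truncated subtraction; the entries of finite-dimensional arrays hold reals and
  admit the field operations and comparison.  There is no rounding, so no real is ever converted
  to an index.  Division by 0 gives 0.\<close>

type_synonym vname = string

datatype iexp =
    IConst nat
  | IVar vname
  | IAdd iexp iexp
  | ISub iexp iexp

datatype rexp =
    RConst int
  | RIndex iexp
  | RGet vname "iexp list"
  | RAdd rexp rexp
  | RSub rexp rexp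
  | RMult rexp rexp
  | RDiv rexp rexp

datatype bexp =
    ILess iexp iexp
  | RLess rexp rexp
  | BNot bexp
  | BAnd bexp bexp

datatype com =
    Skip
  | IAssign vname iexp
  | RAssign vname "iexp list" rexp
  | Seq com com
  | Cond bexp com com
  | While bexp com

record store =
  idx :: "vname \<Rightarrow> nat"
  arr :: "vname \<Rightarrow> nat list \<Rightarrow> real"

fun ival :: "iexp \<Rightarrow> store \<Rightarrow> nat" where
  "ival (IConst k) s = k"
| "ival (IVar x) s = idx s x"
| "ival (IAdd a b) s = ival a s + ival b s"
| "ival (ISub a b) s = ival a s - ival b s"

fun rval :: "rexp \<Rightarrow> store \<Rightarrow> real" where
  "rval (RConst k) s = of_int k"
| "rval (RIndex a) s = of_nat (ival a s)"
| "rval (RGet x is) s = arr s x (map (\<lambda>a. ival a s) is)"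
| "rval (RAdd a b) s = rval a s + rval b s"
| "rval (RSub a b) s = rval a s - rval b s"
| "rval (RMult a b) s = rval a s * rval b s"
| "rval (RDiv a b) s = rval a s / rval b s"

fun bval :: "bexp \<Rightarrow> store \<Rightarrow> bool" where
  "bval (ILess a b) s \<longleftrightarrow> ival a s < ival b s"
| "bval (RLess a b) s \<longleftrightarrow> rval a s < rval b s"
| "bval (BNot b) s \<longleftrightarrow> \<not> bval b s"
| "bval (BAnd a b) s \<longleftrightarrow> bval a s \<and> bval b s"

definition set_idx :: "vname \<Rightarrow> nat \<Rightarrow> store \<Rightarrow> store" where
  "set_idx x k s = s\<lparr>idx := (idx s)(x := k)\<rparr>"

definition set_arr :: "vname \<Rightarrow> nat list \<Rightarrow> real \<Rightarrow> store \<Rightarrow> store" where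
  "set_arr x is v s = s\<lparr>arr := (arr s)(x := (arr s x)(is := v))\<rparr>"

text \<open>\<open>exec w P s t s'\<close>: program \<open>P\<close> started in \<open>s\<close> halts in \<open>s'\<close> after time \<open>t\<close>, where every
  instruction and every test takes one unit and storing the value \<open>v\<close> takes \<open>w v\<close> in addition.
  The weight does not influence the store reached.  Expressions have a size fixed by the program,
  hence need no separate charge.  With \<open>w = (\<lambda>_. 0)\<close> this is the arithmetic (unit-cost) time; with
  \<open>w = bit_size\<close> below it is, up to a polynomial, the Turing time of a run on rational data.\<close>

inductive exec :: "(real \<Rightarrow> nat) \<Rightarrow> com \<Rightarrow> store \<Rightarrow> nat \<Rightarrow> store \<Rightarrow> bool"
  for w :: "real \<Rightarrow> nat" where
  Skip: "exec w Skip s 1 s"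
| IAssign: "exec w (IAssign x a) s (1 + w (of_nat (ival a s))) (set_idx x (ival a s) s)"
| RAssign: "exec w (RAssign x is e) s (1 + w (rval e s))
     (set_arr x (map (\<lambda>a. ival a s) is) (rval e s) s)"
| Seq: "exec w P s t s' \<Longrightarrow> exec w Q s' t' s'' \<Longrightarrow> exec w (Seq P Q) s (t + t') s''"
| CondTrue: "bval b s \<Longrightarrow> exec w P s t s' \<Longrightarrow> exec w (Cond b P Q) s (1 + t) s'"
| CondFalse: "\<not> bval b s \<Longrightarrow> exec w Q s t s' \<Longrightarrow> exec w (Cond b P Q) s (1 + t) s'"
| WhileFalse: "\<not> bval b s \<Longrightarrow> exec w (While b P) s 1 s"
| WhileTrue: "bval b s \<Longrightarrow> exec w P s t s' \<Longrightarrow> exec w (While b P) s' t' s''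
     \<Longrightarrow> exec w (While b P) s (1 + t + t') s''"

text \<open>Binary length of a rational number; the minimum is attained by the reduced fraction.  The
  value at irrational arguments is unspecified and never used.\<close>

definition bit_size :: "real \<Rightarrow> nat" where
  "bit_size x = (LEAST k. \<exists>(a::int) (b::nat). b > 0 \<and> x = of_int a / of_nat b \<and>
     k = floorlog 2 (nat \<bar>a\<bar>) + floorlog 2 b)"


section \<open>Polynomial time reductions\<close>

text \<open>The input tuple is stored as \<open>A[i,j,k] = (A\<^sub>i)\<^sub>j\<^sub>k\<close>; everything else is initially zero.\<close>

definition input_store :: "nat \<Rightarrow> (nat \<Rightarrow> real mat) \<Rightarrow> store" where
  "input_store n A =
     \<lparr>idx = (\<lambda>_. 0)(''n'' := n),
      arr = (\<lambda>x is. case is of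
               [i, j, k] \<Rightarrow> if x = ''A'' \<and> i < n \<and> j < n \<and> k < n then A i $$ (j, k) else 0
             | _ \<Rightarrow> 0)\<rparr>"

definition output_store ::
    "store \<Rightarrow> nat \<Rightarrow> real mat \<Rightarrow> int vec \<Rightarrow> int \<Rightarrow> real \<Rightarrow> bool" where
  "output_store s m L c C \<alpha> \<longleftrightarrow>
     idx s ''m'' = m \<and>
     L = mat m m (\<lambda>(i, j). arr s ''L'' [i, j]) \<and>
     c \<in> carrier_vec m \<and> (\<forall>i<m. arr s ''c'' [i] = of_int (c $ i)) \<and>
     arr s ''C'' [] = of_int C \<and>
     arr s ''alpha'' [] = \<alpha>"

definition computes ::
    "com \<Rightarrow> nat \<Rightarrow> (nat \<Rightarrow> real mat) \<Rightarrow> nat \<Rightarrow> real mat \<Rightarrow> int vec \<Rightarrow> int \<Rightarrow> real \<Rightarrow> bool" where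
  "computes P n A m L c C \<alpha> \<longleftrightarrow>
     (\<exists>t s. exec (\<lambda>_. 0) P (input_store n A) t s \<and> output_store s m L c C \<alpha>)"

definition rational_input :: "nat \<Rightarrow> (nat \<Rightarrow> real mat) \<Rightarrow> bool" where
  "rational_input n A \<longleftrightarrow> (\<forall>i<n. \<forall>j<n. \<forall>k<n. A i $$ (j, k) \<in> \<rat>)"

definition input_bits :: "nat \<Rightarrow> (nat \<Rightarrow> real mat) \<Rightarrow> nat" where
  "input_bits n A = n + (\<Sum>i<n. \<Sum>j<n. \<Sum>k<n. bit_size (A i $$ (j, k)))"

text \<open>Polynomial time for inputs consisting of real numbers, in the usual sense of a strongly
  polynomial algorithm: on every instance the number of arithmetic operations is polynomial in \<open>n\<close>,
  and on rational instances the bit cost is polynomial in the binary input length.  The output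
  dimension \<open>m\<close> is bounded along with the time, since array entries the program never writes are
  zero and it could otherwise announce an output larger than its running time.\<close>

definition poly_time :: "com \<Rightarrow> (nat \<times> (nat \<Rightarrow> real mat)) set \<Rightarrow> bool" where
  "poly_time P I \<longleftrightarrow>
     (\<exists>p :: nat poly. \<forall>(n, A) \<in> I.
        \<exists>t s. exec (\<lambda>_. 0) P (input_store n A) t s \<and> t + idx s ''m'' \<le> poly p n) \<and>
     (\<exists>q :: nat poly. \<forall>(n, A) \<in> I. rational_input n A \<longrightarrow>
        (\<exists>t s. exec bit_size P (input_store n A) t s \<and> t \<le> poly q (input_bits n A)))"

end

theory Submission
  imports Defs
begin

text \<open>Symmetric Gaussian elimination \<open>A' = A - a\<^sub>k a\<^sub>k\<^sup>T / a\<^sub>k\<^sub>k\<close> writes \<open>A\<^sub>i\<close> as a sum of rank one terms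
  \<open>d\<^sub>i\<^sub>k u\<^sub>i\<^sub>k u\<^sub>i\<^sub>k\<^sup>T\<close> with \<open>d\<^sub>i\<^sub>k \<ge> 0\<close>, using field operations only.  A zero pivot of a positive semidefinite
  matrix lies in a zero row, so the convention \<open>x / 0 = 0\<close> makes the step harmless.  Then the mixed
  discriminant is the sum of \<open>(\<Prod>i. d\<^sub>i\<^sub>\<kappa>\<^sub>i) (det (u\<^sub>1\<^sub>\<kappa>\<^sub>1, \<dots>, u\<^sub>n\<^sub>\<kappa>\<^sub>n))\<^sup>2\<close> over all choices \<open>\<kappa>\<close>.

  Scaling the vectors by \<open>sqrt d\<^sub>i\<^sub>k\<close> would leave the field of the input.  Instead \<open>L\<close> is the direct sum
  of the Gram matrix of the \<open>n\<^sup>2\<close> vectors and the diagonal matrix of the \<open>n\<^sup>2\<close> weights, and the costs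
  force that in every block \<open>i\<close> exactly one vector and exactly the matching weight are chosen.
  This takes three digits to a cost_base of order \<open>n\<^sup>2\<close> per block, hence the bound \<open>2 powr O(n log n)\<close>.

  The bit cost is controlled because the entries arising in the elimination are quotients of minors
  of the input.\<close>

section \<open>Mixed discriminants\<close>

text \<open>The two sides agree term by term, so \<alpha> = 1 suffices. A principal minor of the
  direct sum is a Gram determinant, that is a squared determinant of the chosen vectors, times a
  product of chosen weights. It equals one term of the expanded mixed discriminant as soon as the
  weights belong to the chosen vectors. A vector and its weight are separate elements of the ground
  set, and nothing in the determinant ties them together, so the costs have to: a vector at position
  k pays k, a weight at position k pays n - 1 - k, and with one of each the sum is n - 1 exactly
  when the positions agree.

  On the machine side the danger is growth of the stored numbers. All entries of one elimination
  stage share a single short denominator, so an inner product of two columns has a denominator whose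
  length does not depend on the number of terms. The program is analysed once for an abstract
  storage weight, which covers arithmetic time and bit time together.\<close>

lemma partial_deriv_monomials:
  fixes c :: "'g \<Rightarrow> real"
  assumes "finite G" "i < n" "\<And>g. g \<in> G \<Longrightarrow> (\<And>z. \<phi> g i z = z ^ e g)"
  shows "partial_deriv i (\<lambda>z. \<Sum>g\<in>G. c g * (\<Prod>j<n. \<phi> g j (z j))) =
    (\<lambda>z. \<Sum>g\<in>G. c g * (\<Prod>j<n. if j = i then real (e g) * z i ^ (e g - 1) else \<phi> g j (z j)))"
proof
  fix z :: "nat \<Rightarrow> real"
  have split: "(\<Prod>j<n. h j) = h i * (\<Prod>j\<in>{..<n}-{i}. h j)" for h :: "nat \<Rightarrow> real"
    using assms(2) by (subst prod.remove[of _ i]) auto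
  have "((\<lambda>t. \<Sum>g\<in>G. c g * (t ^ e g * (\<Prod>j\<in>{..<n}-{i}. \<phi> g j (z j)))) has_field_derivative
     (\<Sum>g\<in>G. c g * ((real (e g) * z i ^ (e g - 1)) * (\<Prod>j\<in>{..<n}-{i}. \<phi> g j (z j))))) (at (z i))"
    by (auto intro!: derivative_eq_intros sum.cong simp: mult_ac)
  moreover have "(\<lambda>t. \<Sum>g\<in>G. c g * (\<Prod>j<n. \<phi> g j ((z(i := t)) j))) =
     (\<lambda>t. \<Sum>g\<in>G. c g * (t ^ e g * (\<Prod>j\<in>{..<n}-{i}. \<phi> g j (z j))))"
    unfolding split using assms(3) by (intro ext sum.cong refl) auto
  ultimately show "partial_deriv i (\<lambda>z. \<Sum>g\<in>G. c g * (\<Prod>j<n. \<phi> g j (z j))) z =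
    (\<Sum>g\<in>G. c g * (\<Prod>j<n. if j = i then real (e g) * z i ^ (e g - 1) else \<phi> g j (z j)))"
    unfolding partial_deriv_def split by (simp add: DERIV_imp_deriv)
qed

text \<open>Distinctness of \<open>xs\<close> ensures that variable \<open>i\<close> still carries a
  bare power when its turn comes, which is the form that the single step requires; factors in the
  other variables are opaque to it.\<close>

lemma iterated_partial_deriv_monomials:
  fixes c :: "'g \<Rightarrow> real"
  assumes "finite G" "distinct xs" "set xs \<subseteq> {..<n}"
  shows "foldr partial_deriv xs (\<lambda>z. \<Sum>g\<in>G. c g * (\<Prod>j<n. z j ^ e g j)) =
    (\<lambda>z. \<Sum>g\<in>G. c g *
      (\<Prod>j<n. if j \<in> set xs then real (e g j) * z j ^ (e g j - 1) else z j ^ e g j))"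
  using assms(2,3)
proof (induction xs)
  case (Cons i xs)
  then have *: "foldr partial_deriv (i # xs) (\<lambda>z. \<Sum>g\<in>G. c g * (\<Prod>j<n. z j ^ e g j)) =
     partial_deriv i (\<lambda>z. \<Sum>g\<in>G. c g *
      (\<Prod>j<n. (\<lambda>x. if j \<in> set xs then real (e g j) * x ^ (e g j - 1) else x ^ e g j) (z j)))"
    by simp
  show ?case
    unfolding * using Cons.prems assms(1)
    by (subst partial_deriv_monomials[where e = "\<lambda>g. e g i"]) (auto intro!: ext sum.cong prod.cong)
qed simp

section \<open>Determinants with sums and factors in the rows\<close>

lemma permutes_lessThan_iff: "p permutes {0..<n} \<Longrightarrow> p r < n \<longleftrightarrow> r < n" for p :: "nat \<Rightarrow> nat"
  using permutes_in_image[of p "{0..<n}" r] by simp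

lemma det_row_sums:
  fixes M :: "nat \<Rightarrow> nat \<Rightarrow> nat \<Rightarrow> real"
  assumes "finite I"
  shows "Determinant.det (mat n n (\<lambda>(j, k). \<Sum>i\<in>I. M i j k)) =
    (\<Sum>g\<in>PiE {..<n} (\<lambda>_. I). Determinant.det (mat n n (\<lambda>(j, k). M (g j) j k)))"
proof -
  have "Determinant.det (mat n n (\<lambda>(j, k). \<Sum>i\<in>I. M i j k)) =
     (\<Sum>p | p permutes {0..<n}. signof p * (\<Prod>r<n. \<Sum>i\<in>I. M i r (p r)))"
    unfolding det_def'[OF mat_carrier]
    by (intro sum.cong refl arg_cong2[where f = "(*)"] prod.cong) (auto simp: atLeast0LessThan permutes_lessThan_iff)
  also have "\<dots> = (\<Sum>p | p permutes {0..<n}. \<Sum>g\<in>PiE {..<n} (\<lambda>_. I).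
      signof p * (\<Prod>r<n. M (g r) r (p r)))"
    using assms by (simp add: prod_sum_PiE sum_distrib_left)
  also have "\<dots> = (\<Sum>g\<in>PiE {..<n} (\<lambda>_. I). \<Sum>p | p permutes {0..<n}.
      signof p * (\<Prod>r<n. M (g r) r (p r)))"
    by (rule sum.swap)
  also have "\<dots> = (\<Sum>g\<in>PiE {..<n} (\<lambda>_. I). Determinant.det (mat n n (\<lambda>(j, k). M (g j) j k)))"
    unfolding det_def'[OF mat_carrier]
    by (intro sum.cong refl arg_cong2[where f = "(*)"] prod.cong) (auto simp: atLeast0LessThan permutes_lessThan_iff)
  finally show ?thesis .
qed

lemma det_scale_rows:
  fixes M :: "nat \<Rightarrow> nat \<Rightarrow> real"
  shows "Determinant.det (mat n n (\<lambda>(j, k). a j * M j k)) =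
    (\<Prod>j<n. a j) * Determinant.det (mat n n (\<lambda>(j, k). M j k))"
proof -
  have "Determinant.det (mat n n (\<lambda>(j, k). a j * M j k)) =
    (\<Sum>p | p permutes {0..<n}. signof p * (\<Prod>r<n. a r * M r (p r)))"
    unfolding det_def'[OF mat_carrier]
    by (intro sum.cong refl arg_cong2[where f = "(*)"] prod.cong) (auto simp: atLeast0LessThan permutes_lessThan_iff)
  also have "\<dots> = (\<Prod>j<n. a j) * (\<Sum>p | p permutes {0..<n}. signof p * (\<Prod>r<n. M r (p r)))"
    by (simp add: prod.distrib sum_distrib_left mult_ac)
  also have "(\<Sum>p | p permutes {0..<n}. signof p * (\<Prod>r<n. M r (p r))) =
     Determinant.det (mat n n (\<lambda>(j, k). M j k))"
    unfolding det_def'[OF mat_carrier]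
    by (intro sum.cong refl arg_cong2[where f = "(*)"] prod.cong) (auto simp: atLeast0LessThan permutes_lessThan_iff)
  finally show ?thesis .
qed

lemma prod_apply_eq_prod_power:
  fixes z :: "nat \<Rightarrow> real"
  assumes "g \<in> PiE {..<n} (\<lambda>_. {..<n})"
  shows "(\<Prod>r<n. z (g r)) = (\<Prod>i<n. z i ^ card {r. r < n \<and> g r = i})"
proof -
  have "(\<Prod>r<n. z (g r)) = (\<Prod>i<n. \<Prod>r | r \<in> {..<n} \<and> g r = i. z (g r))"
    using assms by (intro prod.group[symmetric]) auto
  also have "\<dots> = (\<Prod>i<n. z i ^ card {r. r < n \<and> g r = i})"
    by (intro prod.cong refl) auto
  finally show ?thesis .
qed

lemma extensional_permutation_iff:
  fixes g :: "nat \<Rightarrow> nat"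
  assumes "g \<in> PiE {..<n} (\<lambda>_. {..<n})"
  shows "(\<forall>i<n. card {r. r < n \<and> g r = i} = 1) \<longleftrightarrow> bij_betw g {..<n} {..<n}"
proof
  assume *: "\<forall>i<n. card {r. r < n \<and> g r = i} = 1"
  have "\<exists>r<n. g r = i" if "i < n" for i
  proof -
    have "{r. r < n \<and> g r = i} \<noteq> {}" using * that by (metis card.empty zero_neq_one)
    then show ?thesis by auto
  qed
  then have "g ` {..<n} = {..<n}" using assms by auto
  then show "bij_betw g {..<n} {..<n}" using eq_card_imp_inj_on[OF finite_lessThan, of g n] by (simp add: bij_betw_def)
next
  assume *: "bij_betw g {..<n} {..<n}"
  show "\<forall>i<n. card {r. r < n \<and> g r = i} = 1"
  proof (intro allI impI)
    fix i assume "i < n"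
    then have "i \<in> g ` {..<n}" using * by (simp add: bij_betw_def)
    then obtain r where "r < n" "g r = i" by blast
    then have "{r. r < n \<and> g r = i} = {r}" using * by (auto simp: bij_betw_def inj_on_def)
    then show "card {r. r < n \<and> g r = i} = 1" by simp
  qed
qed

text \<open>Multilinearity in the rows gives one monomial for each map \<open>g\<close> from rows to
  matrices. The mixed derivative at the origin keeps only the monomial in which every variable has
  exponent 1, and this singles out the bijective \<open>g\<close>.\<close>

lemma mixed_discriminant_rows:
  "mixed_discriminant n A =
    (\<Sum>g | g permutes {..<n}. Determinant.det (mat n n (\<lambda>(j, k). A (g j) $$ (j, k))))"
proof -
  let ?G = "PiE {..<n} (\<lambda>_. {..<n})"
  define c where "c g = Determinant.det (mat n n (\<lambda>(j, k). A (g j) $$ (j, k)))" for g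
  define e where "e g i = card {r. r < n \<and> g r = i}" for g :: "nat \<Rightarrow> nat" and i
  have fin: "finite ?G" by (intro finite_PiE) auto
  have "Determinant.det (pencil n A z) = (\<Sum>g\<in>?G. c g * (\<Prod>i<n. z i ^ e g i))" for z
  proof -
    have "Determinant.det (pencil n A z) =
      (\<Sum>g\<in>?G. Determinant.det (mat n n (\<lambda>(j, k). z (g j) * A (g j) $$ (j, k))))"
      unfolding pencil_def by (rule det_row_sums) simp
    also have "\<dots> = (\<Sum>g\<in>?G. c g * (\<Prod>i<n. z i ^ e g i))"
      by (intro sum.cong refl)
        (simp add: det_scale_rows c_def e_def prod_apply_eq_prod_power[symmetric])
    finally show ?thesis .
  qed
  then have "mixed_discriminant n A = (\<Sum>g\<in>?G. c g * (\<Prod>i<n. real (e g i) * 0 ^ (e g i - 1)))"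
    using fin by (simp add: mixed_discriminant_def iterated_partial_deriv_monomials atLeast0LessThan)
  also have "\<dots> = (\<Sum>g\<in>?G. if bij_betw g {..<n} {..<n} then c g else 0)"
  proof (intro sum.cong refl)
    fix g assume g: "g \<in> ?G"
    \<comment> \<open>For k = 0 the truncated exponent gives \<open>0 ^ 0 = 1\<close>; it is the
      factor \<open>real k\<close> that makes the product vanish.\<close>
    have *: "real k * 0 ^ (k - 1) = (if k = 1 then 1 else 0)" for k
      by (cases k) auto
    have "(\<Prod>i<n. real (e g i) * 0 ^ (e g i - 1)) = (if \<forall>i<n. e g i = 1 then 1 else 0 :: real)"
      unfolding * by auto
    then show "c g * (\<Prod>i<n. real (e g i) * 0 ^ (e g i - 1)) =
        (if bij_betw g {..<n} {..<n} then c g else 0)"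
      using extensional_permutation_iff[OF g] by (simp add: e_def)
  qed
  also have "\<dots> = (\<Sum>g | g \<in> ?G \<and> bij_betw g {..<n} {..<n}. c g)"
    using fin by (simp add: sum.inter_filter)
  \<comment> \<open>Members of \<open>PiE\<close> are undefined outside \<open>{..<n}\<close>,
    whereas permutations are the identity there; the bijection only changes these outer
    values.\<close>
  also have "\<dots> = (\<Sum>g | g permutes {..<n}. c g)"
  proof (rule sum.reindex_bij_witness[where i = "\<lambda>p. restrict p {..<n}"
      and j = "\<lambda>g i. if i < n then g i else i"])
    fix g assume g: "g \<in> {g \<in> ?G. bij_betw g {..<n} {..<n}}"
    then show "restrict (\<lambda>i. if i < n then g i else i) {..<n} = g"
      by (auto simp: fun_eq_iff PiE_def extensional_def)
    show "(\<lambda>i. if i < n then g i else i) \<in> {g. g permutes {..<n}}"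
    proof -
      have "bij_betw (\<lambda>i. if i < n then g i else i) {..<n} {..<n} \<longleftrightarrow> bij_betw g {..<n} {..<n}"
        by (rule bij_betw_cong) simp
      then have "(\<lambda>i. if i < n then g i else i) permutes {..<n}"
        using g by (intro bij_imp_permutes) auto
      then show ?thesis by simp
    qed
    show "c (\<lambda>i. if i < n then g i else i) = c g"
      unfolding c_def by (intro arg_cong[where f = Determinant.det] eq_matI) auto
  next
    fix p assume p: "p \<in> {g. g permutes {..<n}}"
    then show "(\<lambda>i. if i < n then restrict p {..<n} i else i) = p"
      by (auto simp: fun_eq_iff permutes_def)
    show "restrict p {..<n} \<in> {g \<in> ?G. bij_betw g {..<n} {..<n}}"
      using p permutes_imp_bij[of p "{..<n}"] permutes_in_image[of p "{..<n}"]
      by (auto simp: bij_betw_def inj_on_def)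
  qed
  finally show ?thesis by (simp add: c_def)
qed

text \<open>Row j is a multiple of the vector \<open>U (g j)\<close>. Pulling out the factors leaves
  one matrix with permuted rows, and the resulting sign turns the sum over \<open>g\<close> into a
  second Leibniz expansion of the same determinant. This evaluates the mixed discriminant of n rank
  one matrices.\<close>

lemma sum_permuted_rank_one:
  fixes U :: "nat \<Rightarrow> nat \<Rightarrow> real"
  shows "(\<Sum>g | g permutes {..<n}. Determinant.det (mat n n (\<lambda>(j, k). U (g j) j * U (g j) k))) =
    (Determinant.det (mat n n (\<lambda>(l, i). U i l)))\<^sup>2"
proof -
  let ?V = "mat n n (\<lambda>(i, l). U i l)"
  have V: "Determinant.det ?V = Determinant.det (mat n n (\<lambda>(l, i). U i l))"
    by (subst det_transpose[symmetric, of _ n]) (auto intro!: arg_cong[where f = Determinant.det])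
  have "Determinant.det (mat n n (\<lambda>(j, k). U (g j) j * U (g j) k)) =
     signof g * (\<Prod>j<n. U (g j) j) * Determinant.det ?V" if g: "g permutes {..<n}" for g
  proof -
    have "Determinant.det (mat n n (\<lambda>(j, k). U (g j) j * U (g j) k)) =
       (\<Prod>j<n. U (g j) j) * Determinant.det (mat n n (\<lambda>(j, k). U (g j) k))"
      by (rule det_scale_rows)
    also have "mat n n (\<lambda>(j, k). U (g j) k) = mat n n (\<lambda>(j, k). ?V $$ (g j, k))"
      using g by (intro eq_matI) (auto simp: permutes_in_image[of g "{..<n}", simplified])
    also have "Determinant.det \<dots> = signof g * Determinant.det ?V"
      using g by (intro det_permute_rows) (auto simp: atLeast0LessThan)
    finally show ?thesis by simp
  qed
  then have "(\<Sum>g | g permutes {..<n}. Determinant.det (mat n n (\<lambda>(j, k). U (g j) j * U (g j) k))) =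
    (\<Sum>g | g permutes {..<n}. signof g * (\<Prod>j<n. U (g j) j)) * Determinant.det ?V"
    by (simp add: sum_distrib_right)
  also have "(\<Sum>g | g permutes {..<n}. signof g * (\<Prod>j<n. U (g j) j)) =
     Determinant.det (mat n n (\<lambda>(l, i). U i l))"
    unfolding det_def'[OF mat_carrier]
    by (intro sum.cong arg_cong2[where f = "(*)"] prod.cong)
      (auto simp: atLeast0LessThan permutes_in_image[of _ "{..<n}", simplified])
  finally show ?thesis by (simp add: V power2_eq_square)
qed

lemma mixed_discriminant_rank_one_sums:
  fixes d :: "nat \<Rightarrow> nat \<Rightarrow> real" and u :: "nat \<Rightarrow> nat \<Rightarrow> nat \<Rightarrow> real"
  assumes "\<And>i p q. i < n \<Longrightarrow> p < n \<Longrightarrow> q < n \<Longrightarrow> A i $$ (p, q) = (\<Sum>k<n. d i k * u i k p * u i k q)"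
  shows "mixed_discriminant n A = (\<Sum>\<kappa>\<in>PiE {..<n} (\<lambda>_. {..<n}).
    (\<Prod>i<n. d i (\<kappa> i)) * (Determinant.det (mat n n (\<lambda>(l, i). u i (\<kappa> i) l)))\<^sup>2)"
proof -
  let ?G = "PiE {..<n} (\<lambda>_. {..<n})"
  have "Determinant.det (mat n n (\<lambda>(j, k). A (g j) $$ (j, k))) =
    (\<Sum>\<kappa>\<in>?G. (\<Prod>i<n. d i (\<kappa> i)) *
       Determinant.det (mat n n (\<lambda>(j, k). u (g j) (\<kappa> (g j)) j * u (g j) (\<kappa> (g j)) k)))"
    if g: "g permutes {..<n}" for g
  proof -
    have gn: "g j < n" if "j < n" for j using g that permutes_in_image[of g "{..<n}" j] by simp
    have ign: "inv_into UNIV g j < n" if "j < n" for j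
      using permutes_inv[OF g] that permutes_in_image[of "inv_into UNIV g" "{..<n}" j] by simp
    have "Determinant.det (mat n n (\<lambda>(j, k). A (g j) $$ (j, k))) =
      Determinant.det (mat n n (\<lambda>(j, k). \<Sum>l<n. d (g j) l * (u (g j) l j * u (g j) l k)))"
      using assms gn by (intro arg_cong[where f = Determinant.det] eq_matI) (auto simp: mult.assoc)
    also have "\<dots> = (\<Sum>\<kappa>\<in>?G. Determinant.det
        (mat n n (\<lambda>(j, k). d (g j) (\<kappa> j) * (u (g j) (\<kappa> j) j * u (g j) (\<kappa> j) k))))"
      by (rule det_row_sums) simp
    also have "\<dots> = (\<Sum>\<kappa>\<in>?G. (\<Prod>j<n. d (g j) (\<kappa> j)) *
       Determinant.det (mat n n (\<lambda>(j, k). u (g j) (\<kappa> j) j * u (g j) (\<kappa> j) k)))"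
      by (simp add: det_scale_rows)
    also have "\<dots> = (\<Sum>\<kappa>\<in>?G. (\<Prod>j<n. d (g j) (\<kappa> (g j))) *
       Determinant.det (mat n n (\<lambda>(j, k). u (g j) (\<kappa> (g j)) j * u (g j) (\<kappa> (g j)) k)))"
    \<comment> \<open>The row expansion chooses a term for each row. Composing with \<open>g\<close>
      turns this into a choice for each matrix, so that the product of weights becomes independent
      of \<open>g\<close> and can leave the sum over \<open>g\<close>.\<close>
    proof (rule sum.reindex_bij_witness[where i = "\<lambda>\<kappa>. restrict (\<kappa> \<circ> g) {..<n}"
        and j = "\<lambda>\<kappa>. restrict (\<kappa> \<circ> inv_into UNIV g) {..<n}"])
      fix \<kappa> assume k: "\<kappa> \<in> ?G"
      show "restrict (restrict (\<kappa> \<circ> inv_into UNIV g) {..<n} \<circ> g) {..<n} = \<kappa>"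
           "restrict (restrict (\<kappa> \<circ> g) {..<n} \<circ> inv_into UNIV g) {..<n} = \<kappa>"
        using k gn ign permutes_inverses[OF g]
        by (auto simp: fun_eq_iff PiE_def extensional_def)
      show "restrict (\<kappa> \<circ> inv_into UNIV g) {..<n} \<in> ?G" "restrict (\<kappa> \<circ> g) {..<n} \<in> ?G"
        using k gn ign by (auto simp: PiE_def)
      show "(\<Prod>j<n. d (g j) (restrict (\<kappa> \<circ> inv_into UNIV g) {..<n} (g j))) *
         Determinant.det (mat n n (\<lambda>(j, k). u (g j) (restrict (\<kappa> \<circ> inv_into UNIV g) {..<n} (g j)) j
            * u (g j) (restrict (\<kappa> \<circ> inv_into UNIV g) {..<n} (g j)) k)) =
        (\<Prod>j<n. d (g j) (\<kappa> j)) *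
         Determinant.det (mat n n (\<lambda>(j, k). u (g j) (\<kappa> j) j * u (g j) (\<kappa> j) k))"
        using gn permutes_inverses[OF g]
        by (intro arg_cong2[where f = "(*)"] prod.cong arg_cong[where f = Determinant.det] eq_matI) auto
    qed
    also have "\<dots> = (\<Sum>\<kappa>\<in>?G. (\<Prod>i<n. d i (\<kappa> i)) *
       Determinant.det (mat n n (\<lambda>(j, k). u (g j) (\<kappa> (g j)) j * u (g j) (\<kappa> (g j)) k)))"
    proof (intro sum.cong refl arg_cong2[where f = "(*)"])
      fix \<kappa>
      show "(\<Prod>j<n. d (g j) (\<kappa> (g j))) = (\<Prod>i<n. d i (\<kappa> i))"
        using prod.permute[OF g, of "\<lambda>i. d i (\<kappa> i)"] by (simp add: o_def)
    qed
    finally show ?thesis .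
  qed
  then have "mixed_discriminant n A = (\<Sum>g | g permutes {..<n}. \<Sum>\<kappa>\<in>?G. (\<Prod>i<n. d i (\<kappa> i)) *
       Determinant.det (mat n n (\<lambda>(j, k). u (g j) (\<kappa> (g j)) j * u (g j) (\<kappa> (g j)) k)))"
    by (simp add: mixed_discriminant_rows)
  also have "\<dots> = (\<Sum>\<kappa>\<in>?G. (\<Prod>i<n. d i (\<kappa> i)) * (\<Sum>g | g permutes {..<n}.
       Determinant.det (mat n n (\<lambda>(j, k). u (g j) (\<kappa> (g j)) j * u (g j) (\<kappa> (g j)) k))))"
    by (subst sum.swap) (simp add: sum_distrib_left)
  also have "\<dots> = (\<Sum>\<kappa>\<in>?G.
    (\<Prod>i<n. d i (\<kappa> i)) * (Determinant.det (mat n n (\<lambda>(l, i). u i (\<kappa> i) l)))\<^sup>2)"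
  proof (intro sum.cong refl arg_cong2[where f = "(*)"])
    fix \<kappa>
    show "(\<Sum>g | g permutes {..<n}.
       Determinant.det (mat n n (\<lambda>(j, k). u (g j) (\<kappa> (g j)) j * u (g j) (\<kappa> (g j)) k))) =
      (Determinant.det (mat n n (\<lambda>(l, i). u i (\<kappa> i) l)))\<^sup>2"
      using sum_permuted_rank_one[of n "\<lambda>i. u i (\<kappa> i)"] by simp
  qed
  finally show ?thesis .
qed

section \<open>Symmetric elimination without square roots\<close>

text \<open>Row and column k are not deleted; for a positive semidefinite matrix they become zero
  instead, so all stages share the index range of the input.\<close>

fun schur :: "(nat \<Rightarrow> nat \<Rightarrow> real) \<Rightarrow> nat \<Rightarrow> nat \<Rightarrow> nat \<Rightarrow> real" where
  "schur M 0 p q = M p q"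
| "schur M (Suc k) p q = schur M k p q - schur M k p k * schur M k k q / schur M k k k"

definition qform :: "nat \<Rightarrow> (nat \<Rightarrow> nat \<Rightarrow> real) \<Rightarrow> (nat \<Rightarrow> real) \<Rightarrow> real" where
  "qform n M x = (\<Sum>i<n. \<Sum>j<n. x i * M i j * x j)"

definition sympsd :: "nat \<Rightarrow> (nat \<Rightarrow> nat \<Rightarrow> real) \<Rightarrow> bool" where
  "sympsd n M \<longleftrightarrow> (\<forall>i<n. \<forall>j<n. M i j = M j i) \<and> (\<forall>x. 0 \<le> qform n M x)"

section \<open>Positive semidefinite forms under one pivot step\<close>

lemma qform_shift:
  assumes "\<forall>i<n. \<forall>j<n. M i j = M j i" "k < n"
  shows "qform n M (\<lambda>i. x i + (if i = k then t else 0)) =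
    qform n M x + 2 * t * (\<Sum>j<n. M k j * x j) + t\<^sup>2 * M k k"
proof -
  have "qform n M (\<lambda>i. x i + (if i = k then t else 0)) =
     (\<Sum>i<n. \<Sum>j<n. x i * M i j * x j + (if i = k then t * M k j * x j else 0)
       + (if j = k then x i * M i k * t else 0) + (if i = k then if j = k then t * M k k * t else 0 else 0))"
    unfolding qform_def by (intro sum.cong refl) (auto simp: algebra_simps)
  also have "\<dots> = qform n M x + (\<Sum>i<n. \<Sum>j<n. if i = k then t * M k j * x j else 0)
      + (\<Sum>i<n. x i * M i k * t) + t * M k k * t"
  proof -
    have *: "(\<Sum>i<n. \<Sum>j<n. if i = k then if j = k then t * M k k * t else 0 else 0) = t * M k k * t"
    proof -
      have "(\<Sum>i<n. \<Sum>j<n. if i = k then if j = k then t * M k k * t else 0 else 0)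
         = (\<Sum>i<n. if i = k then t * M k k * t else 0)"
        using assms(2) by (intro sum.cong refl) (auto simp: sum.delta)
      then show ?thesis using assms(2) by (simp add: sum.delta)
    qed
    show ?thesis
      using assms(2) by (simp only: sum.distrib *) (simp add: qform_def sum.delta)
  qed
  also have "(\<Sum>i<n. \<Sum>j<n. if i = k then t * M k j * x j else 0) = t * (\<Sum>j<n. M k j * x j)"
  proof -
    have "(\<Sum>i<n. \<Sum>j<n. if i = k then t * M k j * x j else 0)
      = (\<Sum>i<n. if i = k then \<Sum>j<n. t * M k j * x j else 0)"
      by (intro sum.cong refl) auto
    then show ?thesis using assms(2) by (simp add: sum.delta sum_distrib_left mult.assoc)
  qed
  also have "(\<Sum>i<n. x i * M i k * t) = t * (\<Sum>j<n. M k j * x j)"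
    using assms by (auto simp: sum_distrib_left intro!: sum.cong)
  finally show ?thesis by (simp add: power2_eq_square algebra_simps)
qed

lemma sympsd_diag_nonneg:
  assumes "sympsd n M" "k < n"
  shows "0 \<le> M k k"
proof -
  have "qform n M (\<lambda>i. 0 + (if i = k then 1 else 0)) = M k k"
    using assms by (subst qform_shift) (auto simp: sympsd_def qform_def)
  then show ?thesis using assms(1) unfolding sympsd_def by metis
qed

text \<open>If the entry were nonzero, the form at \<open>e_j + t e_k\<close> would be affine in t
  with nonzero slope; \<open>t\<close> is chosen so that the value is -1.\<close>

lemma sympsd_zero_pivot:
  assumes "sympsd n M" "k < n" "j < n" "M k k = 0"
  shows "M k j = 0"
proof (rule ccontr)
  assume ne: "M k j \<noteq> 0"
  have sym: "\<forall>i<n. \<forall>j<n. M i j = M j i" using assms(1) by (simp add: sympsd_def)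
  define x where "x = (\<lambda>i. if i = j then 1 else 0::real)"
  define t where "t = - (qform n M x + 1) / (2 * M k j)"
  have "(\<Sum>l<n. M k l * x l) = M k j"
    using assms(3) by (simp add: x_def if_distrib[where f = "(*) _"] cong: if_cong)
  then have "qform n M (\<lambda>i. x i + (if i = k then t else 0)) = -1"
    using qform_shift[OF sym assms(2), of x t] assms(4) ne by (simp add: t_def field_simps)
  then show False using assms(1) unfolding sympsd_def by (metis neg_0_le_iff_le not_one_le_zero)
qed

text \<open>Completing the square: the new form at x is the old form at x moved along the k-th axis
  by the minimising shift \<open>- (s / M k k)\<close>. With a zero pivot the shift is 0 and the
  form does not change.\<close>

lemma sympsd_schur_step:
  assumes "sympsd n M" "k < n"
  shows "sympsd n (\<lambda>p q. M p q - M p k * M k q / M k k)"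
proof -
  have sym: "\<forall>i<n. \<forall>j<n. M i j = M j i" using assms(1) by (simp add: sympsd_def)
  have "0 \<le> qform n (\<lambda>p q. M p q - M p k * M k q / M k k) x" for x
  proof -
    define s where "s = (\<Sum>j<n. M k j * x j)"
    have s': "(\<Sum>i<n. x i * M i k) = s"
      unfolding s_def using sym assms(2) by (intro sum.cong) auto
    have "qform n (\<lambda>p q. M p q - M p k * M k q / M k k) x
      = qform n M x - (\<Sum>i<n. \<Sum>j<n. (x i * M i k) * (M k j * x j) / M k k)"
      by (simp add: qform_def sum_subtractf[symmetric] algebra_simps)
    also have "(\<Sum>i<n. \<Sum>j<n. (x i * M i k) * (M k j * x j) / M k k) = s * s / M k k"
      by (simp add: sum_divide_distrib[symmetric] sum_product[symmetric] s' s_def[symmetric])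
    also have "qform n M x - s * s / M k k
       = qform n M (\<lambda>i. x i + (if i = k then - (s / M k k) else 0))"
      unfolding qform_shift[OF sym assms(2)] s_def[symmetric]
      by (cases "M k k = 0") (auto simp: power2_eq_square field_simps)
    also have "\<dots> \<ge> 0" using assms(1) by (simp add: sympsd_def)
    finally show ?thesis .
  qed
  with sym assms(2) show ?thesis by (auto simp: sympsd_def)
qed

section \<open>The complete elimination\<close>

lemma schur_Suc:
  "schur M (Suc k) = (\<lambda>p q. schur M k p q - schur M k p k * schur M k k q / schur M k k k)"
  by (intro ext) simp

lemma sympsd_schur: "sympsd n M \<Longrightarrow> k \<le> n \<Longrightarrow> sympsd n (schur M k)"
proof (induction k)
  case (Suc k)
  then show ?case using sympsd_schur_step[of n "schur M k" k] by (simp only: schur_Suc)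
qed (simp add: sympsd_def qform_def)

text \<open>In row k either the pivot is nonzero and the row is subtracted from itself, or it is
  zero and \<open>sympsd_zero_pivot\<close> shows that the row was zero already. Earlier rows stay
  zero because their correction contains an entry of the same row.\<close>

lemma schur_eliminated:
  assumes "sympsd n M" "k \<le> n" "p < k" "q < n"
  shows "schur M k p q = 0"
  using assms(2-4)
proof (induction k arbitrary: q)
  case (Suc k)
  let ?S = "schur M k"
  have psd: "sympsd n ?S" using sympsd_schur[OF assms(1)] Suc.prems by simp
  show ?case
  proof (cases "p = k")
    case True
    then show ?thesis
      using sympsd_zero_pivot[OF psd, of k q] Suc.prems by (cases "?S k k = 0") auto
  next
    case False
    then show ?thesis using Suc by simp
  qed
qed simp

text \<open>Telescoping: the rank one terms subtracted so far account for the difference between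
  \<open>M\<close> and the current stage, and stage n is zero. The columns stay unnormalised, which
  is why the weight is the reciprocal of the pivot.\<close>

lemma schur_decomposition:
  assumes "sympsd n M" "p < n" "q < n"
  shows "M p q = (\<Sum>k<n. (1 / schur M k k k) * schur M k p k * schur M k q k)"
proof -
  have "M p q - (\<Sum>j<k. schur M j p j * schur M j j q / schur M j j j) = schur M k p q" for k
    by (induction k) (auto simp: algebra_simps)
  from this[of n] have "M p q = (\<Sum>k<n. schur M k p k * schur M k k q / schur M k k k)"
    using schur_eliminated[OF assms(1) order_refl assms(2,3)] by simp
  also have "\<dots> = (\<Sum>k<n. (1 / schur M k k k) * schur M k p k * schur M k q k)"
    using sympsd_schur[OF assms(1)] assms(3) by (intro sum.cong refl) (simp add: sympsd_def)
  finally show ?thesis .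
qed

section \<open>Minors\<close>

text \<open>Lists rather than sets, so that rows and columns can be appended in a prescribed order
  without tracking signs.\<close>

definition minor :: "(nat \<Rightarrow> nat \<Rightarrow> 'a::comm_ring_1) \<Rightarrow> nat list \<Rightarrow> nat list \<Rightarrow> 'a" where
  "minor M I J = Determinant.det (mat (length I) (length I) (\<lambda>(a, b). M (I ! a) (J ! b)))"

text \<open>One step of block elimination: the bordered matrix is a block lower triangular matrix,
  carrying the pivot and its Schur complement, times a block upper triangular one with unit diagonal
  blocks.\<close>

lemma minor_Cons:
  fixes M :: "nat \<Rightarrow> nat \<Rightarrow> real"
  assumes "M k k \<noteq> 0" "length I = length J"
  shows "minor M (k # I) (k # J) = M k k * minor (\<lambda>p q. M p q - M p k * M k q / M k k) I J"
proof -
  let ?s = "length I"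
  let ?S = "mat ?s ?s (\<lambda>(a, b). M (I!a) (J!b) - M (I!a) k * M k (J!b) / M k k)"
  let ?X = "four_block_mat (mat 1 1 (\<lambda>_. M k k)) (0\<^sub>m 1 ?s) (mat ?s 1 (\<lambda>(a, _). M (I!a) k)) ?S"
  let ?Y = "four_block_mat (1\<^sub>m 1) (mat 1 ?s (\<lambda>(_, b). M k (J!b) / M k k)) (0\<^sub>m ?s 1) (1\<^sub>m ?s)"
  have "mat (length (k # I)) (length (k # I)) (\<lambda>(a, b). M ((k # I) ! a) ((k # J) ! b)) = ?X * ?Y"
  proof -
    have "?X * ?Y = four_block_mat (mat 1 1 (\<lambda>_. M k k)) (mat 1 ?s (\<lambda>(_, b). M k (J!b)))
      (mat ?s 1 (\<lambda>(a, _). M (I!a) k)) (mat ?s ?s (\<lambda>(a, b). M (I!a) (J!b)))"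
      using assms
      by (subst mult_four_block_mat[where ?nr1.0 = 1 and ?n1.0 = 1 and ?n2.0 = "?s"
            and ?nr2.0 = "?s" and ?nc1.0 = 1 and ?nc2.0 = "?s"])
        (auto intro!: cong_four_block_mat eq_matI simp: scalar_prod_def)
    also have "\<dots> = mat (length (k # I)) (length (k # I)) (\<lambda>(a, b). M ((k # I) ! a) ((k # J) ! b))"
      using assms(2) by (intro eq_matI) (auto simp: four_block_mat_def Let_def nth_Cons')
    finally show ?thesis by simp
  qed
  moreover have "Determinant.det (?X * ?Y) = Determinant.det ?X * Determinant.det ?Y"
    by (rule det_mult[where n = "1 + ?s"]) auto
  moreover have "Determinant.det ?X = Determinant.det (mat 1 1 (\<lambda>_. M k k)) * Determinant.det ?S"
    by (rule det_four_block_mat_upper_right_zero[where n = 1 and m = ?s]) auto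
  moreover have "Determinant.det ?Y = Determinant.det (1\<^sub>m 1 :: real mat) * Determinant.det (1\<^sub>m ?s :: real mat)"
    by (rule det_four_block_mat_lower_left_zero[where n = 1 and m = ?s]) auto
  moreover have "Determinant.det (mat 1 1 (\<lambda>_. M k k)) = M k k"
    by (subst det_single) auto
  ultimately show ?thesis by (simp add: minor_def)
qed

lemma minor_singleton: "minor M [p] [q] = M p q"
  by (simp add: minor_def det_single)

lemma minor_Nil: "minor M [] [] = 1"
  by (simp add: minor_def)

text \<open>\<open>K\<close> collects the indices below \<open>k\<close> whose pivot is nonzero; at
  a zero pivot the convention on division leaves the stage unchanged. The lists \<open>I\<close> and
  \<open>J\<close> are arbitrary because the induction takes the next pivot from the front of
  \<open>k # I\<close> and \<open>k # J\<close> into \<open>K\<close>.\<close>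

lemma schur_minor:
  "\<exists>K. set K \<subseteq> {..<k} \<and> length K \<le> k \<and> minor M K K \<noteq> 0 \<and>
    (\<forall>I J. length I = length J \<longrightarrow> minor M (K @ I) (K @ J) = minor M K K * minor (schur M k) I J)"
proof (induction k)
  case 0
  show ?case by (rule exI[of _ "[]"]) (auto simp: minor_Nil minor_def)
next
  case (Suc k)
  let ?S = "schur M k"
  obtain K where K: "set K \<subseteq> {..<k}" "length K \<le> k" "minor M K K \<noteq> 0"
    "\<And>I J. length I = length J \<Longrightarrow> minor M (K @ I) (K @ J) = minor M K K * minor ?S I J"
    using Suc by blast
  show ?case
  proof (cases "?S k k = 0")
    case True
    then show ?thesis using K by (intro exI[of _ K]) auto
  next
    case False
    have new: "minor M (K @ [k]) (K @ [k]) = minor M K K * ?S k k"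
      using K(4)[of "[k]" "[k]"] by (simp add: minor_singleton)
    have "minor M ((K @ [k]) @ I) ((K @ [k]) @ J) = minor M (K @ [k]) (K @ [k]) * minor (schur M (Suc k)) I J"
      if "length I = length J" for I J
      using K(4)[of "k # I" "k # J"] minor_Cons[where M = ?S, OF False that, folded schur_Suc] that new by simp
    then show ?thesis using K(1-3) False new by (intro exI[of _ "K @ [k]"]) (auto simp: schur_Suc)
  qed
qed

lemma schur_eq_minor_ratio:
  "\<exists>K. set K \<subseteq> {..<k} \<and> length K \<le> k \<and> minor M K K \<noteq> 0 \<and>
    (\<forall>p q. schur M k p q = minor M (K @ [p]) (K @ [q]) / minor M K K)"
proof -
  obtain K where K: "set K \<subseteq> {..<k}" "length K \<le> k" "minor M K K \<noteq> 0"
    "\<And>I J. length I = length J \<Longrightarrow> minor M (K @ I) (K @ J) = minor M K K * minor (schur M k) I J"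
    using schur_minor by blast
  then show ?thesis
    using K(4)[of "[_]" "[_]"] by (intro exI[of _ K]) (auto simp: minor_singleton field_simps)
qed

section \<open>Binary sizes\<close>

lemma floorlog_le_Suc: "x \<le> 2 ^ k \<Longrightarrow> floorlog 2 x \<le> k + 1"
  by (intro floorlog_leI) (auto intro: le_less_trans)

text \<open>Any fraction will do, reduced or not, since \<open>bit_size\<close> is a minimum; a
  negative denominator passes its sign to the numerator. The extra 2 appears because
  \<open>2 ^ k\<close> itself has k + 1 binary digits.\<close>

lemma bit_size_le:
  fixes a b :: int
  assumes "b \<noteq> 0" "\<bar>a\<bar> \<le> 2 ^ k" "\<bar>b\<bar> \<le> 2 ^ l"
  shows "bit_size (of_int a / of_int b) \<le> k + l + 2"
proof -
  define c where "c = nat \<bar>b\<bar>"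
  have "bit_size (of_int a / of_int b) \<le> floorlog 2 (nat \<bar>sgn b * a\<bar>) + floorlog 2 c"
    unfolding bit_size_def
  proof (rule Least_le, intro exI conjI)
    show "0 < c" using assms(1) by (simp add: c_def)
    show "(of_int a / of_int b :: real) = of_int (sgn b * a) / of_nat c"
      using assms(1) by (cases "b > 0") (auto simp: c_def)
  qed simp
  also have "\<bar>sgn b * a\<bar> = \<bar>a\<bar>" using assms(1) by (simp add: abs_mult abs_sgn_eq)
  also have "floorlog 2 (nat \<bar>a\<bar>) \<le> k + 1"
    using assms(2) by (intro floorlog_le_Suc) (metis nat_le_iff of_nat_numeral of_nat_power)
  also have "floorlog 2 c \<le> l + 1"
    using assms(3) unfolding c_def
    by (intro floorlog_le_Suc) (metis nat_le_iff of_nat_numeral of_nat_power)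
  finally show ?thesis by simp
qed

lemma bit_size_of_int_le: "\<bar>a\<bar> \<le> 2 ^ k \<Longrightarrow> bit_size (of_int a) \<le> k + 2"
  using bit_size_le[of 1 a k 0] by simp

lemma int_le_two_power: "N \<le> 2 ^ t \<Longrightarrow> int N \<le> 2 ^ t"
  by (metis of_nat_le_iff of_nat_numeral of_nat_power)

lemma bit_size_of_nat_le: "a \<le> 2 ^ k \<Longrightarrow> bit_size (of_nat a) \<le> k + 2"
  using bit_size_of_int_le[of "int a" k] int_le_two_power[of a k] by simp

lemma bit_size_witness:
  assumes "x \<in> \<rat>"
  obtains a :: int and b :: nat where "b > 0" "x = of_int a / of_nat b"
    "\<bar>a\<bar> < 2 ^ bit_size x" "b < 2 ^ bit_size x"
proof -
  let ?P = "\<lambda>k. \<exists>(a::int) (b::nat). b > 0 \<and> x = of_int a / of_nat b \<and>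
     k = floorlog 2 (nat \<bar>a\<bar>) + floorlog 2 b"
  obtain p q where "q > 0" "x = of_int p / of_int q"
    using assms by (metis Rats_cases')
  then have "?P (floorlog 2 (nat \<bar>p\<bar>) + floorlog 2 (nat q))"
    by (intro exI[of _ p] exI[of _ "nat q"]) auto
  then have "?P (bit_size x)" unfolding bit_size_def by (rule LeastI)
  then obtain a :: int and b :: nat where ab: "b > 0" "x = of_int a / of_nat b"
    "bit_size x = floorlog 2 (nat \<bar>a\<bar>) + floorlog 2 b" by blast
  have "nat \<bar>a\<bar> < 2 ^ bit_size x" "b < 2 ^ bit_size x"
    by (rule floorlog_leD; simp add: ab(3))+
  then have "\<bar>a\<bar> < 2 ^ bit_size x" "b < 2 ^ bit_size x"
    by (auto simp: nat_less_iff)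
  with ab(1,2) show thesis by (rule that)
qed

section \<open>Minors of rational matrices and their size\<close>

lemma minor_of_int: "minor (\<lambda>p q. of_int (M p q) :: real) I J = of_int (minor M I J)"
proof -
  have "mat (length I) (length I) (\<lambda>(a, b). of_int (M (I ! a) (J ! b)) :: real) =
    map_mat of_int (mat (length I) (length I) (\<lambda>(a, b). M (I ! a) (J ! b)))"
    by (intro eq_matI) auto
  then show ?thesis by (simp only: minor_def of_int_hom.hom_det)
qed

lemma minor_scale: "minor (\<lambda>p q. c * M p q) I J = c ^ length I * minor M I J"
proof -
  have "mat (length I) (length I) (\<lambda>(a, b). c * M (I ! a) (J ! b)) =
    c \<cdot>\<^sub>m mat (length I) (length I) (\<lambda>(a, b). M (I ! a) (J ! b))"
    by (intro eq_matI) auto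
  then show ?thesis by (simp add: minor_def)
qed

lemma minor_cong:
  assumes "length J = length I"
    "\<And>p q. p \<in> set I \<Longrightarrow> q \<in> set J \<Longrightarrow> M p q = M' p q"
  shows "minor M I J = minor M' I J"
  using assms unfolding minor_def by (intro arg_cong[where f = Determinant.det] eq_matI) auto

lemma abs_minor_le:
  fixes M :: "nat \<Rightarrow> nat \<Rightarrow> int"
  assumes "length J = length I" "\<And>p q. p \<in> set I \<Longrightarrow> q \<in> set J \<Longrightarrow> \<bar>M p q\<bar> \<le> \<beta>"
  shows "\<bar>minor M I J\<bar> \<le> fact (length I) * \<beta> ^ length I"
proof -
  let ?s = "length I"
  have "\<bar>minor M I J\<bar> \<le> (\<Sum>p | p permutes {0..<?s}. \<bar>signof p * (\<Prod>r<?s. M (I ! r) (J ! p r))\<bar>)"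
    unfolding minor_def det_def'[OF mat_carrier]
    by (rule order_trans[OF sum_abs], intro sum_mono) (auto simp: abs_mult atLeast0LessThan abs_prod intro!: mult_left_mono prod_mono)
  also have "\<dots> \<le> (\<Sum>p | p permutes {0..<?s}. \<beta> ^ ?s)"
  proof (rule sum_mono)
    fix p assume "p \<in> {p. p permutes {0..<?s}}"
    then have lt: "p r < ?s" if "r < ?s" for r
      using that permutes_in_image[of p "{0..<?s}" r] by simp
    have "\<bar>signof p * (\<Prod>r<?s. M (I ! r) (J ! p r))\<bar> = (\<Prod>r<?s. \<bar>M (I ! r) (J ! p r)\<bar>)"
      by (cases p rule: sign_cases) (auto simp: abs_prod)
    also have "\<dots> \<le> (\<Prod>r<?s. \<beta>)"
      using assms lt by (intro prod_mono) auto
    finally show "\<bar>signof p * (\<Prod>r<?s. M (I ! r) (J ! p r))\<bar> \<le> \<beta> ^ ?s" by simp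
  qed
  also have "\<dots> = fact ?s * \<beta> ^ ?s" by (simp add: card_permutations)
  finally show ?thesis .
qed

lemma fact_le_two_power: "fact (k :: nat) \<le> (2 :: int) ^ (k * k)"
proof -
  have "fact k \<le> k ^ k" using fact_le_power[of k, where 'a = nat] by simp
  also have "(k :: nat) ^ k \<le> (2 ^ k) ^ k" by (intro power_mono) (auto intro: less_imp_le[OF less_exp])
  finally have "fact k \<le> (2 :: nat) ^ (k * k)" by (simp add: power_mult)
  then have "int (fact k) \<le> int (2 ^ (k * k))" by (simp only: of_nat_le_iff)
  then show ?thesis by simp
qed

text \<open>The two minors in \<open>schur_eq_minor_ratio\<close> differ in size by one, so the
  powers of \<open>N\<close> cancel down to a single factor. Thus \<open>N * minor B K K\<close> is
  a denominator for all entries of the stage at once. The exponent collects a factorial of at most n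
  + 1, at most n + 1 entries bounded by \<open>2 ^ t\<close>, and \<open>N\<close> itself.\<close>

lemma schur_rational:
  fixes B :: "nat \<Rightarrow> nat \<Rightarrow> int" and N :: nat
  assumes M: "\<And>p q. p < n \<Longrightarrow> q < n \<Longrightarrow> M p q = of_int (B p q) / of_nat N"
    and N: "0 < N" "N \<le> 2 ^ t" and B: "\<And>p q. p < n \<Longrightarrow> q < n \<Longrightarrow> \<bar>B p q\<bar> \<le> 2 ^ t" and k: "k \<le> n"
  shows "\<exists>D::int. D \<noteq> 0 \<and> \<bar>D\<bar> \<le> 2 ^ (Suc n * Suc n + Suc n * t + t) \<and>
    (\<forall>p<n. \<forall>q<n. \<exists>x::int. \<bar>x\<bar> \<le> 2 ^ (Suc n * Suc n + Suc n * t + t) \<and> schur M k p q = of_int x / of_int D)"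
proof -
  let ?h = "Suc n * Suc n + Suc n * t + t"
  obtain K where K: "set K \<subseteq> {..<k}" "length K \<le> k" "minor M K K \<noteq> 0"
    "\<And>p q. schur M k p q = minor M (K @ [p]) (K @ [q]) / minor M K K"
    using schur_eq_minor_ratio by blast
  have minor: "minor M I J = (1 / of_nat N) ^ length I * of_int (minor B I J)"
    if "set I \<subseteq> {..<n}" "set J \<subseteq> {..<n}" "length J = length I" for I J
  proof -
    have "minor M I J = minor (\<lambda>p q. (1 / of_nat N) * of_int (B p q)) I J"
      using that M by (intro minor_cong) (auto simp: subset_iff)
    then show ?thesis by (simp only: minor_scale minor_of_int)
  qed
  have bound: "\<bar>minor B I J\<bar> \<le> 2 ^ (Suc n * Suc n + Suc n * t)"
    if "set I \<subseteq> {..<n}" "set J \<subseteq> {..<n}" "length J = length I" "length I \<le> Suc n" for I J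
  proof -
    have "\<bar>minor B I J\<bar> \<le> fact (length I) * (2 ^ t) ^ length I"
      using that B by (intro abs_minor_le) (auto simp: subset_iff)
    also have "\<dots> \<le> 2 ^ (length I * length I) * (2 ^ t) ^ length I"
      by (intro mult_right_mono fact_le_two_power) auto
    also have "\<dots> = 2 ^ (length I * length I + length I * t)"
      by (simp add: power_add power_mult mult.commute)
    also have "\<dots> \<le> 2 ^ (Suc n * Suc n + Suc n * t)"
      using that(4) by (intro power_increasing add_mono mult_mono) auto
    finally show ?thesis .
  qed
  have Kn: "set K \<subseteq> {..<n}" using K(1) k by auto
  define D where "D = int N * minor B K K"
  have "minor B K K \<noteq> 0" using K(3) minor[OF Kn Kn] N(1) by auto
  then have "D \<noteq> 0" using N(1) by (simp add: D_def)
  moreover have "\<bar>D\<bar> \<le> 2 ^ ?h"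
  proof -
    have "\<bar>D\<bar> \<le> 2 ^ t * 2 ^ (Suc n * Suc n + Suc n * t)"
      unfolding D_def abs_mult using bound[OF Kn Kn refl] K(2) k int_le_two_power[OF N(2)]
      by (intro mult_mono) auto
    then show ?thesis by (simp add: power_add mult_ac)
  qed
  moreover have "\<exists>x::int. \<bar>x\<bar> \<le> 2 ^ ?h \<and> schur M k p q = of_int x / of_int D" if "p < n" "q < n" for p q
  proof (intro exI conjI)
    have sub: "set (K @ [p]) \<subseteq> {..<n}" "set (K @ [q]) \<subseteq> {..<n}" using Kn that by auto
    have "\<bar>minor B (K @ [p]) (K @ [q])\<bar> \<le> 2 ^ (Suc n * Suc n + Suc n * t)"
      using sub K(2) k by (intro bound) auto
    also have "\<dots> \<le> 2 ^ ?h" by (intro power_increasing) auto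
    finally show "\<bar>minor B (K @ [p]) (K @ [q])\<bar> \<le> 2 ^ ?h" .
    show "schur M k p q = of_int (minor B (K @ [p]) (K @ [q])) / of_int D"
      unfolding K(4) minor[OF Kn Kn refl] using minor[OF sub] N(1) \<open>minor B K K \<noteq> 0\<close>
      by (simp add: D_def field_simps)
  qed
  ultimately show ?thesis by blast
qed

text \<open>The product of all denominators is at most as long as the inputs together. Each
  numerator is multiplied by the remaining denominators, hence the factor 2 in the exponent.\<close>

lemma common_denominator:
  fixes x :: "'a \<Rightarrow> real"
  assumes "finite T" "\<And>j. j \<in> T \<Longrightarrow> x j \<in> \<rat>"
  shows "\<exists>(N::nat) (b :: 'a \<Rightarrow> int). 0 < N \<and> N \<le> 2 ^ (\<Sum>j\<in>T. bit_size (x j)) \<and>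
    (\<forall>j\<in>T. x j = of_int (b j) / of_nat N \<and> \<bar>b j\<bar> \<le> 2 ^ (2 * (\<Sum>j\<in>T. bit_size (x j))))"
proof -
  have "\<forall>j\<in>T. \<exists>(a::int) (d::nat). d > 0 \<and> x j = of_int a / of_nat d \<and>
    \<bar>a\<bar> < 2 ^ bit_size (x j) \<and> d < 2 ^ bit_size (x j)"
    using bit_size_witness[OF assms(2)] by metis
  then obtain a :: "'a \<Rightarrow> int" and d :: "'a \<Rightarrow> nat" where ad: "\<And>j. j \<in> T \<Longrightarrow> d j > 0 \<and>
    x j = of_int (a j) / of_nat (d j) \<and> \<bar>a j\<bar> < 2 ^ bit_size (x j) \<and> d j < 2 ^ bit_size (x j)"
    by metis
  define N where "N = (\<Prod>j\<in>T. d j)"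
  define b where "b j = a j * int (\<Prod>i\<in>T-{j}. d i)" for j
  let ?t = "\<Sum>j\<in>T. bit_size (x j)"
  have N: "N = d j * (\<Prod>i\<in>T-{j}. d i)" if "j \<in> T" for j
    using assms(1) that by (simp add: N_def prod.remove)
  have "0 < N" using ad unfolding N_def by (intro prod_pos) auto
  moreover have leN: "N \<le> 2 ^ ?t"
  proof -
    have "N \<le> (\<Prod>j\<in>T. 2 ^ bit_size (x j))"
      unfolding N_def using ad by (intro prod_mono) (metis less_imp_le zero_le)
    then show ?thesis by (simp add: power_sum)
  qed
  moreover have "x j = of_int (b j) / of_nat N \<and> \<bar>b j\<bar> \<le> 2 ^ (2 * ?t)" if j: "j \<in> T" for j
  proof
    show "x j = of_int (b j) / of_nat N"
      using ad[OF j] \<open>0 < N\<close> unfolding N[OF j] b_def by (simp add: field_simps del: of_nat_prod)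
    have "(\<Prod>i\<in>T-{j}. d i) \<le> N" using ad[OF j] unfolding N[OF j] by simp
    then have "int (\<Prod>i\<in>T-{j}. d i) \<le> 2 ^ ?t"
      using int_le_two_power[of "\<Prod>i\<in>T-{j}. d i" ?t] leN by linarith
    moreover have "\<bar>a j\<bar> \<le> 2 ^ ?t"
    proof -
      have "(2::int) ^ bit_size (x j) \<le> 2 ^ ?t"
        using assms(1) j by (intro power_increasing member_le_sum) auto
      then show ?thesis using ad[OF j] by linarith
    qed
    ultimately have "\<bar>b j\<bar> \<le> 2 ^ ?t * 2 ^ ?t"
      unfolding b_def abs_mult abs_of_nat by (intro mult_mono) (auto simp del: of_nat_prod)
    then show "\<bar>b j\<bar> \<le> 2 ^ (2 * ?t)" by (simp add: power_add mult_2)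
  qed
  ultimately show ?thesis by blast
qed

section \<open>The kernel and its cost function\<close>

lemma sum_lessThan_add:
  "(\<Sum>a<N + M. f a) = (\<Sum>a<N. f a) + (\<Sum>a<M. f (N + a :: nat) :: 'a::comm_monoid_add)"
  by (induction M) (auto simp: add.assoc)

lemma sum_lessThan_square:
  "(\<Sum>a<n * n. f a) = (\<Sum>i<n. \<Sum>k<n. f (i * n + k :: nat) :: 'a::comm_monoid_add)"
proof -
  have "(\<Sum>a<n * n. f a) = (\<Sum>i<n. sum f {i * n..<i * n + n})"
    by (rule sum.nat_group[symmetric])
  also have "\<dots> = (\<Sum>i<n. \<Sum>k<n. f (i * n + k))"
    using sum.shift_bounds_nat_ivl[of f 0 "_ * n" n] by (simp add: atLeast0LessThan add.commute)
  finally show ?thesis .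
qed

lemma digits_unique:
  fixes x y :: "nat \<Rightarrow> nat"
  assumes "\<forall>i<N. x i < Q" "\<forall>i<N. y i < Q" "(\<Sum>i<N. Q ^ i * x i) = (\<Sum>i<N. Q ^ i * y i)"
  shows "\<forall>i<N. x i = y i"
  using assms
proof (induction N arbitrary: x y)
  case (Suc N)
  have shift: "(\<Sum>i<Suc N. Q ^ i * z i) = z 0 + Q * (\<Sum>i<N. Q ^ i * z (Suc i))" for z :: "nat \<Rightarrow> nat"
    by (subst sum.lessThan_Suc_shift) (simp add: sum_distrib_left mult.assoc)
  have lt: "x 0 < Q" "y 0 < Q" using Suc.prems by auto
  have eq: "x 0 + Q * (\<Sum>i<N. Q ^ i * x (Suc i)) = y 0 + Q * (\<Sum>i<N. Q ^ i * y (Suc i))"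
    using Suc.prems(3) unfolding shift .
  have 0: "x 0 = y 0"
    using arg_cong[OF eq, of "\<lambda>t. t mod Q"] lt by simp
  with eq lt have "(\<Sum>i<N. Q ^ i * x (Suc i)) = (\<Sum>i<N. Q ^ i * y (Suc i))" by simp
  with Suc.IH[of "\<lambda>i. x (Suc i)" "\<lambda>i. y (Suc i)"] Suc.prems have "\<forall>i<N. x (Suc i) = y (Suc i)" by simp
  with 0 show ?case by (auto simp: less_Suc_eq_0_disj)
qed simp

lemma sum_digits_less:
  fixes x :: "nat \<Rightarrow> nat"
  assumes "\<forall>i<N. x i < Q"
  shows "(\<Sum>i<N. Q ^ i * x i) < Q ^ N"
  using assms
proof (induction N)
  case (Suc N)
  then have "(\<Sum>i<N. Q ^ i * x i) < Q ^ N" "x N \<le> Q - 1" "0 < Q" by force+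
  then have "(\<Sum>i<Suc N. Q ^ i * x i) < Q ^ N + Q ^ N * (Q - 1)"
    by (simp add: add_less_le_mono)
  also have "\<dots> = Q ^ Suc N"
    using \<open>0 < Q\<close> by (cases Q) (auto simp: algebra_simps)
  finally show ?case .
qed simp

text \<open>Exceeds every digit that a subset can produce: the two counts are at most n, the
  position digit at most \<open>n * (n - 1)\<close>. The 1 matters for n = 1, where a count can
  equal \<open>n * n\<close>.\<close>

definition cost_base :: "nat \<Rightarrow> nat" where
  "cost_base n = n * n + 1"

text \<open>Block \<open>i\<close> consists of the vectors \<open>i * n + k\<close> and the weights \<open>n * n + i * n + k\<close>, where
  \<open>k < n\<close>.  The cost_base \<open>cost_base n\<close> digits \<open>3 * i\<close>, \<open>3 * i + 1\<close> and \<open>3 * i + 2\<close> of the total cost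
  count the chosen vectors of the block, count its chosen weights, and compare their positions.\<close>

definition unit_cost :: "nat \<Rightarrow> nat \<Rightarrow> nat" where
  "unit_cost n a =
    (if a < n * n then (cost_base n ^ 3) ^ (a div n) * (1 + cost_base n ^ 2 * (a mod n))
     else (cost_base n ^ 3) ^ ((a - n * n) div n) *
       (cost_base n + cost_base n ^ 2 * (n - 1 - (a - n * n) mod n)))"

definition target_cost :: "nat \<Rightarrow> nat" where
  "target_cost n = (\<Sum>i<n. (cost_base n ^ 3) ^ i * (1 + cost_base n + cost_base n ^ 2 * (n - 1)))"

definition vectors :: "nat \<Rightarrow> nat set \<Rightarrow> nat \<Rightarrow> nat set" where
  "vectors n S i = {k. k < n \<and> i * n + k \<in> S}"

definition weights :: "nat \<Rightarrow> nat set \<Rightarrow> nat \<Rightarrow> nat set" where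
  "weights n S i = {k. k < n \<and> n * n + (i * n + k) \<in> S}"

definition block_cost :: "nat \<Rightarrow> nat set \<Rightarrow> nat set \<Rightarrow> nat" where
  "block_cost n V W =
    card V + cost_base n * card W + cost_base n ^ 2 * ((\<Sum>k\<in>V. k) + (\<Sum>k\<in>W. n - 1 - k))"

definition selection :: "nat \<Rightarrow> (nat \<Rightarrow> nat) \<Rightarrow> nat set" where
  "selection n \<kappa> = (\<lambda>i. i * n + \<kappa> i) ` {..<n} \<union> (\<lambda>i. n * n + (i * n + \<kappa> i)) ` {..<n}"

lemma pair_index_less: "i < n \<Longrightarrow> k < n \<Longrightarrow> i * n + k < n * n" for i k n :: nat
proof -
  assume "i < n" "k < n"
  then have "i * n + k < Suc i * n" by simp
  also have "\<dots> \<le> n * n" using \<open>i < n\<close> by (intro mult_le_mono1) simp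
  finally show ?thesis .
qed

lemma total_cost_blocks:
  assumes "S \<subseteq> {..<2 * n * n}"
  shows "(\<Sum>a\<in>S. unit_cost n a) =
    (\<Sum>i<n. (cost_base n ^ 3) ^ i * block_cost n (vectors n S i) (weights n S i))"
proof -
  let ?f = "\<lambda>a. if a \<in> S then unit_cost n a else 0"
  have "(\<Sum>a\<in>S. unit_cost n a) = (\<Sum>a<n * n + n * n. ?f a)"
    using assms by (subst sum.inter_restrict[symmetric]) (auto intro!: sum.cong simp: Int_absorb1)
  also have "\<dots> = (\<Sum>i<n. (\<Sum>k<n. ?f (i * n + k)) + (\<Sum>k<n. ?f (n * n + (i * n + k))))"
    by (simp add: sum_lessThan_add sum_lessThan_square sum.distrib)
  also have "\<dots> = (\<Sum>i<n. (cost_base n ^ 3) ^ i * block_cost n (vectors n S i) (weights n S i))"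
  proof (intro sum.cong refl)
    fix i assume "i \<in> {..<n}"
    then have i: "i < n" by simp
    have 1: "(\<Sum>k<n. ?f (i * n + k)) = (\<Sum>k\<in>vectors n S i. (cost_base n ^ 3) ^ i * (1 + cost_base n ^ 2 * k))"
      unfolding vectors_def using i
      by (subst sum.inter_filter[of "{..<n}", simplified]) (auto intro!: sum.cong simp: unit_cost_def pair_index_less)
    have 2: "(\<Sum>k<n. ?f (n * n + (i * n + k))) =
       (\<Sum>k\<in>weights n S i. (cost_base n ^ 3) ^ i * (cost_base n + cost_base n ^ 2 * (n - 1 - k)))"
      unfolding weights_def using i
      by (subst sum.inter_filter[of "{..<n}", simplified]) (auto intro!: sum.cong simp: unit_cost_def)
    show "(\<Sum>k<n. ?f (i * n + k)) + (\<Sum>k<n. ?f (n * n + (i * n + k))) =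
       (cost_base n ^ 3) ^ i * block_cost n (vectors n S i) (weights n S i)"
      unfolding 1 2 block_cost_def sum_distrib_left[symmetric] sum.distrib
      by (simp add: distrib_left mult.commute)
  qed
  finally show ?thesis .
qed

text \<open>These bounds exclude carries for every subset, not only for the intended ones. For the
  position digit both sets are enlarged to all positions, and then k and \<open>n - 1 - k\<close>
  pair up to \<open>n - 1\<close>.\<close>

lemma block_digits:
  assumes "V \<subseteq> {..<n}" "W \<subseteq> {..<n}"
  shows "card V < cost_base n" "card W < cost_base n" "(\<Sum>k\<in>V. k) + (\<Sum>k\<in>W. n - 1 - k) < cost_base n"
proof -
  have "card V \<le> n" "card W \<le> n"
    using card_mono[OF _ assms(1)] card_mono[OF _ assms(2)] by auto
  moreover have "n < cost_base n" by (cases n) (auto simp: cost_base_def)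
  ultimately show "card V < cost_base n" "card W < cost_base n" by auto
  have "(\<Sum>k\<in>V. k) + (\<Sum>k\<in>W. n - 1 - k) \<le> (\<Sum>k<n. k) + (\<Sum>k<n. n - 1 - k)"
    using assms by (intro add_mono sum_mono2) auto
  also have "\<dots> = (\<Sum>k<n. n - 1)"
    by (subst sum.distrib[symmetric]) (auto intro!: sum.cong)
  also have "\<dots> < cost_base n" by (simp add: cost_base_def diff_mult_distrib2)
  finally show "(\<Sum>k\<in>V. k) + (\<Sum>k\<in>W. n - 1 - k) < cost_base n" .
qed

lemma block_cost_eq_sum:
  "block_cost n V W =
    (\<Sum>j<3. cost_base n ^ j * [card V, card W, (\<Sum>k\<in>V. k) + (\<Sum>k\<in>W. n - 1 - k)] ! j)"
  by (simp add: block_cost_def eval_nat_numeral)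

lemma block_cost_less:
  assumes "V \<subseteq> {..<n}" "W \<subseteq> {..<n}"
  shows "block_cost n V W < cost_base n ^ 3"
  unfolding block_cost_eq_sum using block_digits[OF assms]
  by (intro sum_digits_less) (auto simp: less_Suc_eq numeral_3_eq_3)

text \<open>By uniqueness of digits both counts are 1, and the position digit reads
  \<open>v + (n - 1 - w) = n - 1\<close>. Since w < n the subtraction is not truncated, so v =
  w.\<close>

lemma block_cost_eq_iff:
  assumes "0 < n" "V \<subseteq> {..<n}" "W \<subseteq> {..<n}"
  shows "block_cost n V W = 1 + cost_base n + cost_base n ^ 2 * (n - 1) \<longleftrightarrow> (\<exists>k<n. V = {k} \<and> W = {k})"
proof
  assume "block_cost n V W = 1 + cost_base n + cost_base n ^ 2 * (n - 1)"
  then have eq: "(\<Sum>j<3. cost_base n ^ j * [card V, card W, (\<Sum>k\<in>V. k) + (\<Sum>k\<in>W. n - 1 - k)] ! j)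
      = (\<Sum>j<3. cost_base n ^ j * [1, 1, n - 1] ! j)"
    unfolding block_cost_eq_sum[symmetric] by (simp add: eval_nat_numeral)
  have "n - 1 < cost_base n" "1 < cost_base n" using assms(1) by (cases n; simp add: cost_base_def)+
  then have "\<forall>j<3. [card V, card W, (\<Sum>k\<in>V. k) + (\<Sum>k\<in>W. n - 1 - k)] ! j = [1, 1, n - 1] ! j"
    using block_digits[OF assms(2,3)] by (intro digits_unique[OF _ _ eq]) (auto simp: less_Suc_eq numeral_3_eq_3)
  then have *: "card V = 1" "card W = 1" "(\<Sum>k\<in>V. k) + (\<Sum>k\<in>W. n - 1 - k) = n - 1"
    by (auto simp: numeral_3_eq_3 less_Suc_eq all_conj_distrib)
  then obtain v w where vw: "V = {v}" "W = {w}" by (metis card_1_singletonE)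
  then have "v + (n - 1 - w) = n - 1" "w < n" using * assms by auto
  then have "v = w" by linarith
  then show "\<exists>k<n. V = {k} \<and> W = {k}" using vw assms by auto
next
  assume "\<exists>k<n. V = {k} \<and> W = {k}"
  then show "block_cost n V W = 1 + cost_base n + cost_base n ^ 2 * (n - 1)"
    by (auto simp: block_cost_def)
qed

lemma selection_mem:
  assumes "i < n" "k < n" "\<kappa> \<in> PiE {..<n} (\<lambda>_. {..<n})"
  shows "i * n + k \<in> selection n \<kappa> \<longleftrightarrow> k = \<kappa> i" "n * n + (i * n + k) \<in> selection n \<kappa> \<longleftrightarrow> k = \<kappa> i"
proof -
  have inj: "i * n + k = j * n + \<kappa> j \<longleftrightarrow> i = j \<and> k = \<kappa> j" if "j < n" for j
  proof
    assume eq: "i * n + k = j * n + \<kappa> j"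
    have "\<kappa> j < n" using assms(3) that by auto
    then have "(i * n + k) div n = i" "(j * n + \<kappa> j) div n = j"
      using assms(2) by auto
    then show "i = j \<and> k = \<kappa> j" using eq by auto
  qed auto
  have lt: "i * n + k < n * n" "\<And>j. j < n \<Longrightarrow> j * n + \<kappa> j < n * n"
    using assms by (auto intro!: pair_index_less)
  show "i * n + k \<in> selection n \<kappa> \<longleftrightarrow> k = \<kappa> i"
    using inj lt assms(1) by (auto simp: selection_def)
  have "n * n + (i * n + k) \<noteq> j * n + \<kappa> j" if "j < n" for j
    using lt(2)[OF that] by linarith
  then show "n * n + (i * n + k) \<in> selection n \<kappa> \<longleftrightarrow> k = \<kappa> i"
    using inj assms(1) by (auto simp: selection_def)
qed

lemma selection_subset:
  assumes "\<kappa> \<in> PiE {..<n} (\<lambda>_. {..<n})"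
  shows "selection n \<kappa> \<subseteq> {..<2 * n * n}"
proof -
  have "j * n + \<kappa> j < n * n" if "j < n" for j
    using assms that by (auto intro!: pair_index_less)
  then show ?thesis by (force simp: selection_def)
qed

lemma index_cases:
  fixes a n :: nat
  assumes "a < 2 * n * n"
  obtains i k where "i < n" "k < n" "a = i * n + k" | i k where "i < n" "k < n" "a = n * n + (i * n + k)"
proof -
  have *: "b div n < n \<and> b mod n < n \<and> b = (b div n) * n + b mod n" if "b < n * n" for b
    using that by (cases "n = 0") (auto simp: less_mult_imp_div_less)
  show ?thesis
  proof (cases "a < n * n")
    case True
    then show ?thesis using *[of a] that(1) by blast
  next
    case False
    then have "a - n * n < n * n" "a = n * n + (a - n * n)" using assms by auto
    then show ?thesis using *[of "a - n * n"] that(2) by metis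
  qed
qed

lemma target_digit_less: "0 < n \<Longrightarrow> 1 + cost_base n + cost_base n ^ 2 * (n - 1) < cost_base n ^ 3"
  using block_cost_less[of "{0}" n "{0}"] block_cost_eq_iff[of n "{0}" "{0}"] by force

text \<open>Digits are compared on two levels: base \<open>cost_base n ^ 3\<close> separates the
  blocks, and base \<open>cost_base n\<close> separates the three digits within a block.\<close>

lemma target_cost_iff:
  assumes "0 < n" "S \<subseteq> {..<2 * n * n}"
  shows "(\<Sum>a\<in>S. unit_cost n a) = target_cost n \<longleftrightarrow> S \<in> selection n ` PiE {..<n} (\<lambda>_. {..<n})"
proof -
  let ?V = "vectors n S" and ?W = "weights n S"
  have sub: "vectors n T i \<subseteq> {..<n}" "weights n T i \<subseteq> {..<n}" for T i
    by (auto simp: vectors_def weights_def)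
  have "(\<Sum>a\<in>S. unit_cost n a) = target_cost n \<longleftrightarrow>
     (\<forall>i<n. block_cost n (?V i) (?W i) = 1 + cost_base n + cost_base n ^ 2 * (n - 1))"
    unfolding total_cost_blocks[OF assms(2)] target_cost_def
  proof
    assume "(\<Sum>i<n. (cost_base n ^ 3) ^ i * block_cost n (?V i) (?W i)) =
      (\<Sum>i<n. (cost_base n ^ 3) ^ i * (1 + cost_base n + cost_base n ^ 2 * (n - 1)))"
    from digits_unique[OF _ _ this] show "\<forall>i<n. block_cost n (?V i) (?W i) = 1 + cost_base n + cost_base n ^ 2 * (n - 1)"
      using block_cost_less[OF sub] target_digit_less[OF assms(1)] by blast
  qed auto
  also have "\<dots> \<longleftrightarrow> (\<forall>i<n. \<exists>k<n. ?V i = {k} \<and> ?W i = {k})"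
    using block_cost_eq_iff[OF assms(1) sub] by simp
  also have "\<dots> \<longleftrightarrow> S \<in> selection n ` PiE {..<n} (\<lambda>_. {..<n})"
  proof
    assume "\<forall>i<n. \<exists>k<n. ?V i = {k} \<and> ?W i = {k}"
    then obtain \<kappa>' where \<kappa>': "\<And>i. i < n \<Longrightarrow> \<kappa>' i < n \<and> ?V i = {\<kappa>' i} \<and> ?W i = {\<kappa>' i}"
      by metis
    define \<kappa> where "\<kappa> = restrict \<kappa>' {..<n}"
    have \<kappa>: "\<kappa> \<in> PiE {..<n} (\<lambda>_. {..<n})" using \<kappa>' by (auto simp: \<kappa>_def)
    have *: "i * n + k \<in> S \<longleftrightarrow> k = \<kappa> i" "n * n + (i * n + k) \<in> S \<longleftrightarrow> k = \<kappa> i" if "i < n" "k < n" for i k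
      using \<kappa>'[OF that(1)] that by (auto simp: vectors_def weights_def \<kappa>_def)
    have "a \<in> S \<longleftrightarrow> a \<in> selection n \<kappa>" if "a < 2 * n * n" for a
      using that by (cases rule: index_cases) (auto simp: * selection_mem[OF _ _ \<kappa>])
    then have "S = selection n \<kappa>" using assms(2) selection_subset[OF \<kappa>] by blast
    then show "S \<in> selection n ` PiE {..<n} (\<lambda>_. {..<n})" using \<kappa> by blast
  next
    assume "S \<in> selection n ` PiE {..<n} (\<lambda>_. {..<n})"
    then obtain \<kappa> where \<kappa>: "\<kappa> \<in> PiE {..<n} (\<lambda>_. {..<n})" "S = selection n \<kappa>" by blast
    have "?V i = {\<kappa> i} \<and> ?W i = {\<kappa> i} \<and> \<kappa> i < n" if "i < n" for i
    proof -
      have "\<kappa> i < n" using \<kappa>(1) that by auto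
      then show ?thesis
        using selection_mem[OF that _ \<kappa>(1)] by (auto simp: vectors_def weights_def \<kappa>(2))
    qed
    then show "\<forall>i<n. \<exists>k<n. ?V i = {k} \<and> ?W i = {k}" by blast
  qed
  finally show ?thesis .
qed

lemma inj_on_selection: "inj_on (selection n) (PiE {..<n} (\<lambda>_. {..<n}))"
proof (rule inj_onI)
  fix \<kappa> \<kappa>' assume k: "\<kappa> \<in> PiE {..<n} (\<lambda>_. {..<n})" "\<kappa>' \<in> PiE {..<n} (\<lambda>_. {..<n})"
    and eq: "selection n \<kappa> = selection n \<kappa>'"
  show "\<kappa> = \<kappa>'"
  proof (rule PiE_ext[OF k])
    fix i assume "i \<in> {..<n}"
    then have "i < n" "\<kappa> i < n" using k(1) by auto
    then show "\<kappa> i = \<kappa>' i"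
      using selection_mem(1)[OF _ _ k(1), of i "\<kappa> i"] selection_mem(1)[OF _ _ k(2), of i "\<kappa> i"] eq by simp
  qed
qed

definition cost_vec :: "nat \<Rightarrow> int vec" where
  "cost_vec n = vec (2 * n * n) (\<lambda>a. int (unit_cost n a))"

lemma cost_cost_vec: "S \<subseteq> {..<2 * n * n} \<Longrightarrow> cost (cost_vec n) S = int (\<Sum>a\<in>S. unit_cost n a)"
  by (auto simp: cost_def cost_vec_def intro!: sum.cong)

text \<open>The full ground set is one of the subsets without carries, so its cost has at most 3 n
  digits. As all costs are nonnegative, this is the bound on the norm.\<close>

lemma total_unit_cost_less: "(\<Sum>a<2 * n * n. unit_cost n a) < (cost_base n ^ 3) ^ n"
  unfolding total_cost_blocks[OF subset_refl]
  by (intro sum_digits_less allI impI block_cost_less) (auto simp: vectors_def weights_def)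

lemma l1_norm_cost_vec: "l1_norm (cost_vec n) \<le> int ((cost_base n ^ 3) ^ n)"
proof -
  have "l1_norm (cost_vec n) = int (\<Sum>a<2 * n * n. unit_cost n a)"
    by (simp add: l1_norm_def cost_vec_def)
  then show ?thesis using total_unit_cost_less[of n] by linarith
qed

section \<open>The kernel matrix and its principal minors\<close>

definition dpp_kernel :: "nat \<Rightarrow> (nat \<Rightarrow> nat \<Rightarrow> real) \<Rightarrow> (nat \<Rightarrow> nat \<Rightarrow> nat \<Rightarrow> real) \<Rightarrow> nat \<Rightarrow> nat \<Rightarrow> real" where
  "dpp_kernel n d u a b =
    (if a < n * n \<and> b < n * n then \<Sum>l<n. u (a div n) (a mod n) l * u (b div n) (b mod n) l
     else if n * n \<le> a \<and> a = b then d ((a - n * n) div n) ((a - n * n) mod n)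
     else 0)"

definition kernel_mat :: "nat \<Rightarrow> (nat \<Rightarrow> nat \<Rightarrow> real) \<Rightarrow> (nat \<Rightarrow> nat \<Rightarrow> nat \<Rightarrow> real) \<Rightarrow> real mat" where
  "kernel_mat n d u = mat (2 * n * n) (2 * n * n) (\<lambda>(a, b). dpp_kernel n d u a b)"

text \<open>The quadratic form is a sum of n squares, one for each coordinate of the vectors, plus
  squares with the nonnegative weights as coefficients.\<close>

lemma psd_kernel_mat:
  assumes "\<And>i k. i < n \<Longrightarrow> k < n \<Longrightarrow> 0 \<le> d i k"
  shows "psd (2 * n * n) (kernel_mat n d u)"
proof -
  let ?N = "n * n"
  let ?u = "\<lambda>a l. u (a div n) (a mod n) l"
  have sym: "dpp_kernel n d u a b = dpp_kernel n d u b a" for a b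
    by (auto simp: dpp_kernel_def mult.commute)
  have "0 \<le> scalar_prod x (kernel_mat n d u *\<^sub>v x)" if "x \<in> carrier_vec (2 * n * n)" for x
  proof -
    have "scalar_prod x (kernel_mat n d u *\<^sub>v x) =
      (\<Sum>a<?N + ?N. \<Sum>b<?N + ?N. x $ a * dpp_kernel n d u a b * x $ b)"
      using that by (auto simp: scalar_prod_def kernel_mat_def atLeast0LessThan mult_2
        sum_distrib_left mult.assoc distrib_right intro!: sum.cong)
    also have "\<dots> = (\<Sum>a<?N. \<Sum>b<?N. x $ a * dpp_kernel n d u a b * x $ b) +
      (\<Sum>a<?N. \<Sum>b<?N. x $ (?N + a) * dpp_kernel n d u (?N + a) (?N + b) * x $ (?N + b))"
      by (simp add: sum_lessThan_add sum.distrib dpp_kernel_def)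
    also have "(\<Sum>a<?N. \<Sum>b<?N. x $ a * dpp_kernel n d u a b * x $ b) =
      (\<Sum>a<?N. \<Sum>b<?N. \<Sum>l<n. (x $ a * ?u a l) * (x $ b * ?u b l))"
      by (intro sum.cong refl) (auto simp: dpp_kernel_def sum_distrib_left sum_distrib_right mult_ac)
    also have "\<dots> = (\<Sum>l<n. (\<Sum>a<?N. x $ a * ?u a l)\<^sup>2)"
    proof -
      have "(\<Sum>a<?N. \<Sum>b<?N. \<Sum>l<n. (x $ a * ?u a l) * (x $ b * ?u b l)) =
        (\<Sum>a<?N. \<Sum>l<n. \<Sum>b<?N. (x $ a * ?u a l) * (x $ b * ?u b l))"
        by (intro sum.cong refl sum.swap)
      also have "\<dots> = (\<Sum>l<n. \<Sum>a<?N. \<Sum>b<?N. (x $ a * ?u a l) * (x $ b * ?u b l))"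
        by (rule sum.swap)
      finally show ?thesis by (simp add: power2_eq_square sum_product)
    qed
    also have "(\<Sum>a<?N. \<Sum>b<?N. x $ (?N + a) * dpp_kernel n d u (?N + a) (?N + b) * x $ (?N + b)) =
      (\<Sum>a<?N. d (a div n) (a mod n) * (x $ (?N + a))\<^sup>2)"
    proof (intro sum.cong refl)
      fix a assume "a \<in> {..<?N}"
      then have "(\<Sum>b<?N. x $ (?N + a) * dpp_kernel n d u (?N + a) (?N + b) * x $ (?N + b)) =
        (\<Sum>b<?N. if b = a then d (a div n) (a mod n) * (x $ (?N + a))\<^sup>2 else 0)"
        by (intro sum.cong refl) (auto simp: dpp_kernel_def power2_eq_square)
      then show "(\<Sum>b<?N. x $ (?N + a) * dpp_kernel n d u (?N + a) (?N + b) * x $ (?N + b)) =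
        d (a div n) (a mod n) * (x $ (?N + a))\<^sup>2" using \<open>a \<in> {..<?N}\<close> by simp
    qed
    also have "(\<Sum>l<n. (\<Sum>a<?N. x $ a * ?u a l)\<^sup>2) +
        (\<Sum>a<?N. d (a div n) (a mod n) * (x $ (?N + a))\<^sup>2) \<ge> 0"
    proof (intro add_nonneg_nonneg sum_nonneg mult_nonneg_nonneg assms)
      fix a assume "a \<in> {..<?N}"
      then show "a div n < n" "a mod n < n"
        by (cases "n = 0"; simp add: less_mult_imp_div_less)+
    qed auto
    finally show ?thesis .
  qed
  moreover have "transpose_mat (kernel_mat n d u) = kernel_mat n d u"
    by (intro eq_matI) (auto simp: kernel_mat_def sym)
  ultimately show ?thesis by (auto simp: psd_def kernel_mat_def)
qed

text \<open>\<open>pick\<close> lists a set in increasing order, so it must agree with any strictly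
  increasing enumeration.\<close>

lemma pick_strict_mono_image:
  assumes "strict_mono_on {..<N} f" "a < N"
  shows "pick (f ` {..<N}) a = f a"
proof -
  have "{b \<in> f ` {..<N}. b < f a} = f ` {..<a}"
    using strict_mono_on_less[OF assms(1)] assms(2) by auto
  moreover have "inj_on f {..<a}"
    using strict_mono_on_imp_inj_on[OF assms(1)] assms(2) by (auto intro: inj_on_subset)
  ultimately have "card {b \<in> f ` {..<N}. b < f a} = a" by (simp add: card_image)
  then show ?thesis using pick_card_in_set[of "f a" "f ` {..<N}"] assms(2) by auto
qed

lemma submatrix_strict_mono_image:
  assumes "A \<in> carrier_mat m m" "strict_mono_on {..<N} f" "f ` {..<N} \<subseteq> {..<m}"
  shows "submatrix A (f ` {..<N}) (f ` {..<N}) = mat N N (\<lambda>(a, b). A $$ (f a, f b))"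
proof -
  have "{i. i < m \<and> i \<in> f ` {..<N}} = f ` {..<N}" using assms(3) by auto
  then have "card {i. i < m \<and> i \<in> f ` {..<N}} = N"
    using strict_mono_on_imp_inj_on[OF assms(2)] by (simp add: card_image)
  then show ?thesis
    using assms(1,2) by (intro eq_matI) (auto simp: submatrix_def pick_strict_mono_image)
qed

text \<open>On a selection the kernel is block diagonal, with the Gram matrix of the chosen vectors
  and the diagonal matrix of their weights; the Gram block contributes the squared
  determinant.\<close>

lemma dpp_weight_selection:
  assumes "\<kappa> \<in> PiE {..<n} (\<lambda>_. {..<n})"
  shows "dpp_weight (kernel_mat n d u) (selection n \<kappa>) =
    (\<Prod>i<n. d i (\<kappa> i)) * (Determinant.det (mat n n (\<lambda>(l, i). u i (\<kappa> i) l)))\<^sup>2"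
proof -
  \<comment> \<open>The increasing enumeration of the selection: since
    \<open>\<kappa> i < n\<close>, later blocks have larger indices, and all vectors precede all
    weights.\<close>
  define f where "f a = (if a < n then a * n + \<kappa> a else n * n + ((a - n) * n + \<kappa> (a - n)))" for a
  let ?U = "mat n n (\<lambda>(l, i). u i (\<kappa> i) l)"
  let ?D = "mat n n (\<lambda>(i, j). if i = j then d i (\<kappa> i) else 0)"
  have k: "\<kappa> i < n" if "i < n" for i using assms that by auto
  have step: "i * n + \<kappa> i < j * n + \<kappa> j" if "i < j" "j < n" for i j
  proof -
    have "i * n + \<kappa> i < Suc i * n" using k[of i] that by simp
    also have "\<dots> \<le> j * n" using that by (intro mult_le_mono1) simp
    finally show ?thesis by simp
  qed
  have lt: "i * n + \<kappa> i < n * n" if "i < n" for i using that k by (intro pair_index_less) auto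
  have mono: "strict_mono_on {..<n + n} f"
  proof (rule strict_mono_onI)
    fix a b assume ab: "a \<in> {..<n + n}" "b \<in> {..<n + n}" "a < b"
    consider "b < n" | "a < n" "\<not> b < n" | "\<not> a < n" "\<not> b < n" by blast
    then show "f a < f b"
    proof cases
      case 1 then show ?thesis using ab step by (simp add: f_def)
    next
      case 2 then show ?thesis using lt[of a] by (simp add: f_def)
    next
      case 3 then show ?thesis using ab step[of "a - n" "b - n"] by (simp add: f_def)
    qed
  qed
  have "{..<n + n} = {..<n} \<union> (\<lambda>i. n + i) ` {..<n}"
  proof (intro equalityI subsetI)
    fix a assume "a \<in> {..<n + n}"
    then show "a \<in> {..<n} \<union> (\<lambda>i. n + i) ` {..<n}"
      by (cases "a < n") (auto intro!: image_eqI[where x = "a - n"])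
  qed auto
  then have "f ` {..<n + n} = f ` {..<n} \<union> f ` (\<lambda>i. n + i) ` {..<n}"
    by (metis image_Un)
  also have "f ` {..<n} = (\<lambda>i. i * n + \<kappa> i) ` {..<n}"
    by (intro image_cong) (auto simp: f_def)
  also have "f ` (\<lambda>i. n + i) ` {..<n} = (\<lambda>i. n * n + (i * n + \<kappa> i)) ` {..<n}"
    unfolding image_image by (intro image_cong) (auto simp: f_def)
  finally have img: "f ` {..<n + n} = selection n \<kappa>"
    by (simp add: selection_def)
  have "submatrix (kernel_mat n d u) (selection n \<kappa>) (selection n \<kappa>) =
    mat (n + n) (n + n) (\<lambda>(a, b). kernel_mat n d u $$ (f a, f b))"
    unfolding img[symmetric]
    using mono selection_subset[OF assms] img
    by (intro submatrix_strict_mono_image[where m = "2 * n * n"]) (auto simp: kernel_mat_def)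
  also have "\<dots> = four_block_mat (transpose_mat ?U * ?U) (0\<^sub>m n n) (0\<^sub>m n n) ?D"
  proof (rule eq_matI)
    fix a b assume "a < dim_row (four_block_mat (transpose_mat ?U * ?U) (0\<^sub>m n n) (0\<^sub>m n n) ?D)"
      "b < dim_col (four_block_mat (transpose_mat ?U * ?U) (0\<^sub>m n n) (0\<^sub>m n n) ?D)"
    then have ab: "a < n + n" "b < n + n" by auto
    have "f c < 2 * n * n" if "c < n + n" for c
      using selection_subset[OF assms] that unfolding img[symmetric] by auto
    then have "mat (n + n) (n + n) (\<lambda>(a, b). kernel_mat n d u $$ (f a, f b)) $$ (a, b) =
      dpp_kernel n d u (f a) (f b)" using ab by (simp add: kernel_mat_def)
    also have "\<dots> = four_block_mat (transpose_mat ?U * ?U) (0\<^sub>m n n) (0\<^sub>m n n) ?D $$ (a, b)"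
    proof (cases "a < n"; cases "b < n")
      assume "a < n" "b < n"
      then show ?thesis
        using lt k by (simp add: f_def dpp_kernel_def scalar_prod_def atLeast0LessThan)
    next
      assume "a < n" "\<not> b < n"
      then show ?thesis using ab lt[of a] by (simp add: f_def dpp_kernel_def)
    next
      assume "\<not> a < n" "b < n"
      then show ?thesis using ab lt[of b] by (simp add: f_def dpp_kernel_def)
    next
      assume *: "\<not> a < n" "\<not> b < n"
      then have "f a = f b \<longleftrightarrow> a = b"
        using inj_on_eq_iff[OF strict_mono_on_imp_inj_on[OF mono]] ab by simp
      then show ?thesis using * ab k[of "b - n"] by (auto simp: dpp_kernel_def f_def)
    qed
    finally show "mat (n + n) (n + n) (\<lambda>(a, b). kernel_mat n d u $$ (f a, f b)) $$ (a, b) =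
      four_block_mat (transpose_mat ?U * ?U) (0\<^sub>m n n) (0\<^sub>m n n) ?D $$ (a, b)" .
  qed auto
  finally have sub: "submatrix (kernel_mat n d u) (selection n \<kappa>) (selection n \<kappa>) =
    four_block_mat (transpose_mat ?U * ?U) (0\<^sub>m n n) (0\<^sub>m n n) ?D" .
  have "dpp_weight (kernel_mat n d u) (selection n \<kappa>) =
     Determinant.det (transpose_mat ?U * ?U) * Determinant.det ?D"
    unfolding dpp_weight_def sub
    by (rule det_four_block_mat_lower_left_zero[where n = n and m = n]) auto
  also have "Determinant.det (transpose_mat ?U * ?U) = (Determinant.det ?U)\<^sup>2"
    by (subst det_mult[where n = n]) (auto simp: det_transpose[where n = n] power2_eq_square)
  also have "Determinant.det ?D = (\<Prod>i<n. d i (\<kappa> i))"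
    by (subst det_upper_triangular[where n = n])
      (auto simp: upper_triangular_def prod_list_diag_prod atLeast0LessThan)
  finally show ?thesis by (simp add: mult.commute)
qed

lemma dpp_weights_target_cost:
  assumes "0 < n"
  shows "(\<Sum>S | S \<subseteq> {..<2 * n * n} \<and> cost (cost_vec n) S = int (target_cost n).
      dpp_weight (kernel_mat n d u) S) =
    (\<Sum>\<kappa>\<in>PiE {..<n} (\<lambda>_. {..<n}).
      (\<Prod>i<n. d i (\<kappa> i)) * (Determinant.det (mat n n (\<lambda>(l, i). u i (\<kappa> i) l)))\<^sup>2)"
proof -
  have "{S. S \<subseteq> {..<2 * n * n} \<and> cost (cost_vec n) S = int (target_cost n)} =
    selection n ` PiE {..<n} (\<lambda>_. {..<n})"
  proof (intro equalityI subsetI)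
    fix S assume "S \<in> {S. S \<subseteq> {..<2 * n * n} \<and> cost (cost_vec n) S = int (target_cost n)}"
    then have "S \<subseteq> {..<2 * n * n}" "int (\<Sum>a\<in>S. unit_cost n a) = int (target_cost n)"
      using cost_cost_vec by auto
    then show "S \<in> selection n ` PiE {..<n} (\<lambda>_. {..<n})"
      using target_cost_iff[OF assms] by (simp del: of_nat_sum)
  next
    fix S assume S: "S \<in> selection n ` PiE {..<n} (\<lambda>_. {..<n})"
    then have sub: "S \<subseteq> {..<2 * n * n}" using selection_subset by blast
    then have "(\<Sum>a\<in>S. unit_cost n a) = target_cost n" using target_cost_iff[OF assms] S by simp
    then show "S \<in> {S. S \<subseteq> {..<2 * n * n} \<and> cost (cost_vec n) S = int (target_cost n)}"
      using sub cost_cost_vec[OF sub] by (simp del: of_nat_sum)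
  qed
  then show ?thesis
    by (simp add: sum.reindex[OF inj_on_selection] dpp_weight_selection)
qed

section \<open>Single-assignment programs\<close>

text \<open>Every array cell \<open>(x, js)\<close> only ever receives the value \<open>val x js\<close>.  Hence cells that
  hold their final value keep it, and progress is measured by the set of these cells.\<close>

definition agree :: "(vname \<Rightarrow> nat list \<Rightarrow> real) \<Rightarrow> (vname \<times> nat list) set \<Rightarrow> store \<Rightarrow> bool" where
  "agree val D s \<longleftrightarrow> (\<forall>(x, js)\<in>D. arr s x js = val x js)"

text \<open>A Hoare triple with a time bound. Preservation is claimed for every cell that is already
  right, not only for those in \<open>D\<close>, so initial zeros that are final values survive the
  whole run. Restoring the index variables is what lets loops nest.\<close>

definition fills ::
  "(real \<Rightarrow> nat) \<Rightarrow> (vname \<Rightarrow> nat list \<Rightarrow> real) \<Rightarrow> (vname \<Rightarrow> nat) \<Rightarrow> (vname \<times> nat list) set \<Rightarrow>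
    com \<Rightarrow> nat \<Rightarrow> (vname \<times> nat list) set \<Rightarrow> bool" where
  "fills w val \<rho> D P T E \<longleftrightarrow>
    (\<forall>s. idx s = \<rho> \<and> agree val D s \<longrightarrow>
      (\<exists>t s'. exec w P s t s' \<and> t \<le> T \<and> idx s' = \<rho> \<and>
        (\<forall>x js. arr s x js = val x js \<longrightarrow> arr s' x js = val x js) \<and> agree val E s'))"

lemma agree_mono:
  "agree val D s \<Longrightarrow> \<forall>x js. arr s x js = val x js \<longrightarrow> arr s' x js = val x js \<Longrightarrow> agree val D s'"
  by (auto simp: agree_def)

lemma agree_Un: "agree val (D \<union> E) s \<longleftrightarrow> agree val D s \<and> agree val E s"
  by (auto simp: agree_def)

lemma agreeD: "agree val D s \<Longrightarrow> (x, js) \<in> D \<Longrightarrow> arr s x js = val x js"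
  by (auto simp: agree_def)

lemma fills_run:
  assumes "fills w val \<rho> D P T E" "idx s = \<rho>" "agree val D s"
  obtains t s' where "exec w P s t s'" "t \<le> T" "idx s' = \<rho>"
    "\<forall>x js. arr s x js = val x js \<longrightarrow> arr s' x js = val x js" "agree val E s'"
  using assms unfolding fills_def by blast

lemma fills_weaken:
  assumes "fills w val \<rho> D P T E" "D \<subseteq> D'" "T \<le> T'" "E' \<subseteq> E"
  shows "fills w val \<rho> D' P T' E'"
  unfolding fills_def
proof (intro allI impI)
  fix s assume s: "idx s = \<rho> \<and> agree val D' s"
  then have "agree val D s" using assms(2) by (auto simp: agree_def)
  with s obtain t s' where *: "exec w P s t s'" "t \<le> T" "idx s' = \<rho>"
    "\<forall>x js. arr s x js = val x js \<longrightarrow> arr s' x js = val x js" "agree val E s'"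
    using fills_run[OF assms(1)] by metis
  moreover have "agree val E' s'" using *(5) assms(4) by (auto simp: agree_def)
  ultimately show "\<exists>t s'. exec w P s t s' \<and> t \<le> T' \<and> idx s' = \<rho> \<and>
      (\<forall>x js. arr s x js = val x js \<longrightarrow> arr s' x js = val x js) \<and> agree val E' s'"
    using assms(3) le_trans by blast
qed

text \<open>The right-hand side may depend only on index variables and on cells in \<open>D\<close>.
  Storing a final value cannot spoil a cell that is already right.\<close>

lemma fills_assign:
  assumes "\<And>s. idx s = \<rho> \<Longrightarrow> (\<And>y ls. (y, ls) \<in> D \<Longrightarrow> arr s y ls = val y ls) \<Longrightarrow>
      map (\<lambda>a. ival a s) ix = js \<and> rval e s = val x js"
    and "w (val x js) \<le> B"
  shows "fills w val \<rho> D (RAssign x ix e) (1 + B) {(x, js)}"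
  unfolding fills_def
proof (intro allI impI)
  fix s assume s: "idx s = \<rho> \<and> agree val D s"
  then have e: "map (\<lambda>a. ival a s) ix = js" "rval e s = val x js"
    using assms(1)[of s] by (auto simp: agree_def)
  show "\<exists>t s'. exec w (RAssign x ix e) s t s' \<and> t \<le> 1 + B \<and> idx s' = \<rho> \<and>
      (\<forall>x js. arr s x js = val x js \<longrightarrow> arr s' x js = val x js) \<and> agree val {(x, js)} s'"
    using exec.RAssign[of w x ix e s] s assms(2) unfolding e
    by (intro exI conjI) (auto simp: set_arr_def agree_def)
qed

lemma fills_Seq:
  assumes "fills w val \<rho> D P T E" "fills w val \<rho> (D \<union> E) Q T' E'"
  shows "fills w val \<rho> D (Seq P Q) (T + T') (E \<union> E')"
  unfolding fills_def
proof (intro allI impI)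
  fix s assume s: "idx s = \<rho> \<and> agree val D s"
  then obtain t s' where 1: "exec w P s t s'" "t \<le> T" "idx s' = \<rho>"
    "\<forall>x js. arr s x js = val x js \<longrightarrow> arr s' x js = val x js" "agree val E s'"
    using fills_run[OF assms(1)] by metis
  moreover have "agree val (D \<union> E) s'" using agree_mono[OF _ 1(4)] s 1(5) by (simp add: agree_Un)
  ultimately obtain t' s'' where 2: "exec w Q s' t' s''" "t' \<le> T'" "idx s'' = \<rho>"
    "\<forall>x js. arr s' x js = val x js \<longrightarrow> arr s'' x js = val x js" "agree val E' s''"
    using fills_run[OF assms(2)] by metis
  have "agree val (E \<union> E') s''" using agree_mono[OF 1(5) 2(4)] 2(5) by (simp add: agree_Un)
  moreover have "t + t' \<le> T + T'" using 1 2 by simp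
  ultimately show "\<exists>t s'. exec w (Seq P Q) s t s' \<and> t \<le> T + T' \<and> idx s' = \<rho> \<and>
      (\<forall>x js. arr s x js = val x js \<longrightarrow> arr s' x js = val x js) \<and> agree val (E \<union> E') s'"
    using exec.Seq[OF 1(1) 2(1)] 1 2 by blast
qed

text \<open>The variable \<open>y\<close> always holds \<open>n\<close> times the loop counter \<open>x\<close>, because index expressions
  cannot multiply.  Both are reset so that a loop leaves the index variables unchanged.\<close>

definition for_loop :: "vname \<Rightarrow> vname \<Rightarrow> com \<Rightarrow> com" where
  "for_loop x y P =
    Seq (While (ILess (IVar x) (IVar ''n''))
          (Seq P (Seq (IAssign x (IAdd (IVar x) (IConst 1))) (IAssign y (IAdd (IVar y) (IVar ''n''))))))
        (Seq (IAssign x (IConst 0)) (IAssign y (IConst 0)))"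

text \<open>A round pays for the test, the body and two counter updates of at most
  \<open>1 + B\<close> each; the end pays for the failing test and two resets.\<close>

definition loop_time :: "nat \<Rightarrow> nat \<Rightarrow> nat \<Rightarrow> nat" where
  "loop_time n B T = n * (T + 2 * B + 3) + 2 * B + 3"

text \<open>Round k may read what the earlier rounds have filled, as a recurrence in the loop
  counter requires. The weight is bounded up to \<open>n * n\<close> because the companion variable
  climbs that far.\<close>

lemma fills_for_loop:
  assumes \<rho>: "\<rho> x = 0" "\<rho> y = 0" "\<rho> ''n'' = n" "distinct [x, y, ''n'']"
    and w: "\<And>v. v \<le> n * n \<Longrightarrow> w (of_nat v) \<le> B"
    and body: "\<And>k. k < n \<Longrightarrow> fills w val (\<rho>(x := k, y := k * n)) (D \<union> (\<Union>j<k. E j)) P T (E k)"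
  shows "fills w val \<rho> D (for_loop x y P) (loop_time n B T) (\<Union>k<n. E k)"
proof -
  have ne: "x \<noteq> y" "y \<noteq> x" "x \<noteq> ''n''" "''n'' \<noteq> x" "y \<noteq> ''n''" "''n'' \<noteq> y"
    using \<rho>(4) by auto
  let ?step = "Seq (IAssign x (IAdd (IVar x) (IConst 1))) (IAssign y (IAdd (IVar y) (IVar ''n'')))"
  let ?W = "While (ILess (IVar x) (IVar ''n'')) (Seq P ?step)"
  have loop: "\<exists>t s'. exec w ?W s t s' \<and> t \<le> (n - k) * (T + 2 * B + 3) + 1 \<and>
      idx s' = \<rho>(x := n, y := n * n) \<and>
      (\<forall>x js. arr s x js = val x js \<longrightarrow> arr s' x js = val x js) \<and> agree val (\<Union>k<n. E k) s'"
    if "k \<le> n" "idx s = \<rho>(x := k, y := k * n)" "agree val (D \<union> (\<Union>j<k. E j)) s" for k s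
    using that
  proof (induction "n - k" arbitrary: k s)
    case 0
    then have "k = n" by simp
    then have "\<not> bval (ILess (IVar x) (IVar ''n'')) s" using 0 \<rho>(1-3) ne by simp
    from exec.WhileFalse[OF this] show ?case
      using 0 \<open>k = n\<close> by (intro exI conjI) (auto simp: agree_Un)
  next
    case (Suc m)
    then have k: "k < n" by simp
    obtain t s1 where 1: "exec w P s t s1" "t \<le> T" "idx s1 = \<rho>(x := k, y := k * n)"
      "\<forall>x js. arr s x js = val x js \<longrightarrow> arr s1 x js = val x js" "agree val (E k) s1"
      using fills_run[OF body[OF k]] Suc.prems by metis
    define s2 where "s2 = set_idx x (Suc k) s1"
    define s3 where "s3 = set_idx y (Suc k * n) s2"
    have wk: "w (of_nat (Suc k)) \<le> B" "w (of_nat (Suc k * n)) \<le> B"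
      using k by (intro w; metis Suc_leI le_square le_trans mult_le_mono1)+
    have "exec w (IAssign x (IAdd (IVar x) (IConst 1))) s1 (1 + w (of_nat (Suc k))) s2"
      using exec.IAssign[of w x "IAdd (IVar x) (IConst 1)" s1] 1(3) ne by (simp add: s2_def)
    moreover have "exec w (IAssign y (IAdd (IVar y) (IVar ''n''))) s2 (1 + w (of_nat (Suc k * n))) s3"
      using exec.IAssign[of w y "IAdd (IVar y) (IVar ''n'')" s2] 1(3) \<rho>(3) ne
      by (simp add: s2_def s3_def set_idx_def add.commute)
    ultimately have step: "exec w (Seq P ?step) s
       (t + ((1 + w (of_nat (Suc k))) + (1 + w (of_nat (Suc k * n))))) s3"
      using 1(1) by (intro exec.Seq)
    have arr3: "arr s3 = arr s1" by (simp add: s2_def s3_def set_idx_def)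
    have agr: "agree val (D \<union> (\<Union>j<Suc k. E j)) s3"
    proof -
      have "agree val (D \<union> (\<Union>j<k. E j)) s1" using agree_mono[OF Suc.prems(3) 1(4)] .
      then show ?thesis using 1(5) by (auto simp: agree_def arr3 lessThan_Suc)
    qed
    have idx3: "idx s3 = \<rho>(x := Suc k, y := Suc k * n)"
      using 1(3) ne by (auto simp: s2_def s3_def set_idx_def fun_eq_iff)
    have "m = n - Suc k" "Suc k \<le> n" using Suc.hyps(2) k by auto
    from Suc.hyps(1)[OF this idx3 agr] obtain t' s' where 2: "exec w ?W s3 t' s'" "t' \<le> (n - Suc k) * (T + 2 * B + 3) + 1"
      "idx s' = \<rho>(x := n, y := n * n)"
      "\<forall>x js. arr s3 x js = val x js \<longrightarrow> arr s' x js = val x js" "agree val (\<Union>k<n. E k) s'"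
      by blast
    have "bval (ILess (IVar x) (IVar ''n'')) s" using Suc.prems(2) \<rho>(1-3) ne k by simp
    from exec.WhileTrue[OF this step 2(1)]
    have run: "exec w ?W s (1 + (t + ((1 + w (of_nat (Suc k))) + (1 + w (of_nat (Suc k * n))))) + t') s'" .
    have "n - k = Suc (n - Suc k)" using k by simp
    then have "1 + (t + ((1 + w (of_nat (Suc k))) + (1 + w (of_nat (Suc k * n))))) + t'
       \<le> (n - k) * (T + 2 * B + 3) + 1"
      using 1(2) 2(2) wk by simp
    with run show ?case using 1(4) 2 arr3 by (intro exI conjI) auto
  qed
  show ?thesis
    unfolding fills_def
  proof (intro allI impI)
    fix s assume s: "idx s = \<rho> \<and> agree val D s"
    then have "idx s = \<rho>(x := 0, y := 0 * n)" using \<rho> by (auto simp: fun_eq_iff)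
    then obtain t s1 where 1: "exec w ?W s t s1" "t \<le> (n - 0) * (T + 2 * B + 3) + 1"
      "idx s1 = \<rho>(x := n, y := n * n)"
      "\<forall>x js. arr s x js = val x js \<longrightarrow> arr s1 x js = val x js" "agree val (\<Union>k<n. E k) s1"
      using loop[of 0 s] s by auto
    define s2 where "s2 = set_idx y 0 (set_idx x 0 s1)"
    have "exec w (Seq (IAssign x (IConst 0)) (IAssign y (IConst 0))) s1
        ((1 + w (of_nat 0)) + (1 + w (of_nat 0))) s2"
      using exec.IAssign[of w x "IConst 0" s1] exec.IAssign[of w y "IConst 0" "set_idx x 0 s1"]
      unfolding s2_def by (intro exec.Seq[where s' = "set_idx x 0 s1"]) auto
    from exec.Seq[OF 1(1) this] have "exec w (for_loop x y P) s
        (t + ((1 + w (of_nat 0)) + (1 + w (of_nat 0)))) s2" by (simp add: for_loop_def)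
    moreover have "t + ((1 + w (of_nat 0)) + (1 + w (of_nat 0))) \<le> loop_time n B T"
      using 1(2) w[of 0] by (simp add: loop_time_def)
    moreover have "idx s2 = \<rho>"
      using 1(3) \<rho>(1-3) ne by (auto simp: s2_def set_idx_def fun_eq_iff)
    moreover have "arr s2 = arr s1" by (simp add: s2_def set_idx_def)
    ultimately show "\<exists>t s'. exec w (for_loop x y P) s t s' \<and> t \<le> loop_time n B T \<and>
      idx s' = \<rho> \<and> (\<forall>x js. arr s x js = val x js \<longrightarrow> arr s' x js = val x js) \<and>
      agree val (\<Union>k<n. E k) s'"
      using 1(4,5) by (intro exI[of _ "t + ((1 + w (of_nat 0)) + (1 + w (of_nat 0)))"] exI[of _ s2])
        (auto simp: agree_def)
  qed
qed

text \<open>For rounds that do not read each other's results: the precondition stays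
  \<open>D\<close>, so nests of such loops can be peeled off in one go.\<close>

lemma fills_for_loop_indep:
  assumes "\<rho> x = 0" "\<rho> y = 0" "\<rho> ''n'' = n" "distinct [x, y, ''n'']"
    and "\<And>v. v \<le> n * n \<Longrightarrow> w (of_nat v) \<le> B"
    and "\<And>k. k < n \<Longrightarrow> fills w val (\<rho>(x := k, y := k * n)) D P T (E k)"
  shows "fills w val \<rho> D (for_loop x y P) (loop_time n B T) (\<Union>k<n. E k)"
  using assms by (intro fills_for_loop) (auto intro: fills_weaken)

section \<open>The reduction\<close>

definition pivoted :: "(nat \<Rightarrow> real mat) \<Rightarrow> nat \<Rightarrow> nat \<Rightarrow> nat \<Rightarrow> nat \<Rightarrow> real" where
  "pivoted A i = schur (\<lambda>p r. A i $$ (p, r))"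

definition pivot_weight :: "(nat \<Rightarrow> real mat) \<Rightarrow> nat \<Rightarrow> nat \<Rightarrow> real" where
  "pivot_weight A i k = 1 / pivoted A i k k k"

definition pivot_column :: "(nat \<Rightarrow> real mat) \<Rightarrow> nat \<Rightarrow> nat \<Rightarrow> nat \<Rightarrow> real" where
  "pivot_column A i k l = pivoted A i k l k"

definition partial_target :: "nat \<Rightarrow> nat \<Rightarrow> nat" where
  "partial_target n i = (\<Sum>j<i. (cost_base n ^ 3) ^ j * (1 + cost_base n + cost_base n ^ 2 * (n - 1)))"

definition partial_gram :: "(nat \<Rightarrow> real mat) \<Rightarrow> nat \<Rightarrow> nat \<Rightarrow> nat \<Rightarrow> nat \<Rightarrow> nat \<Rightarrow> real" where
  "partial_gram A i k p r l = (\<Sum>l'<l. pivot_column A i k l' * pivot_column A p r l')"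

text \<open>Where one would usually overwrite, the arrays carry an extra index: the stage in
  \<open>S\<close>, the number of summands in \<open>G\<close>, the number of factors in
  \<open>Q\<close> and of blocks in \<open>T\<close>. This gives every cell a single intended
  value.\<close>

definition cell_value :: "nat \<Rightarrow> (nat \<Rightarrow> real mat) \<Rightarrow> vname \<Rightarrow> nat list \<Rightarrow> real" where
  "cell_value n A x js =
    (if x = ''A'' then (case js of [i, p, r] \<Rightarrow> if i < n \<and> p < n \<and> r < n then A i $$ (p, r) else 0 | _ \<Rightarrow> 0)
     else if x = ''S'' then (case js of [i, k, p, r] \<Rightarrow> pivoted A i k p r | _ \<Rightarrow> 0)
     else if x = ''G'' then (case js of [i, k, p, r, l] \<Rightarrow> partial_gram A i k p r l | _ \<Rightarrow> 0)
     else if x = ''L'' then (case js of [a, b] \<Rightarrow> dpp_kernel n (pivot_weight A) (pivot_column A) a b | _ \<Rightarrow> 0)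
     else if x = ''Q'' then (case js of [i] \<Rightarrow> real ((cost_base n ^ 3) ^ i) | _ \<Rightarrow> 0)
     else if x = ''c'' then (case js of [a] \<Rightarrow> real (unit_cost n a) | _ \<Rightarrow> 0)
     else if x = ''T'' then (case js of [i] \<Rightarrow> real (partial_target n i) | _ \<Rightarrow> 0)
     else if x = ''C'' then real (target_cost n)
     else if x = ''alpha'' then 1
     else 0)"

section \<open>The program\<close>

definition base_exp :: rexp where
  "base_exp = RAdd (RMult (RIndex (IVar ''n'')) (RIndex (IVar ''n''))) (RConst 1)"

definition dimensions_prog :: com where
  "dimensions_prog =
    Seq (While (ILess (IVar ''i'') (IVar ''n''))
          (Seq (IAssign ''q'' (IAdd (IVar ''q'') (IVar ''n'')))
               (IAssign ''i'' (IAdd (IVar ''i'') (IConst 1)))))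
    (Seq (IAssign ''i'' (IConst 0)) (IAssign ''m'' (IAdd (IVar ''q'') (IVar ''q''))))"

definition copy_prog :: com where
  "copy_prog =
    for_loop ''i'' ''ii'' (for_loop ''p'' ''pp'' (for_loop ''r'' ''rr''
      (RAssign ''S'' [IVar ''i'', IConst 0, IVar ''p'', IVar ''r'']
        (RGet ''A'' [IVar ''i'', IVar ''p'', IVar ''r'']))))"

definition eliminate_prog :: com where
  "eliminate_prog =
    for_loop ''k'' ''kk'' (for_loop ''i'' ''ii'' (for_loop ''p'' ''pp'' (for_loop ''r'' ''rr''
      (RAssign ''S'' [IVar ''i'', IAdd (IVar ''k'') (IConst 1), IVar ''p'', IVar ''r'']
        (RSub (RGet ''S'' [IVar ''i'', IVar ''k'', IVar ''p'', IVar ''r''])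
          (RDiv (RMult (RGet ''S'' [IVar ''i'', IVar ''k'', IVar ''p'', IVar ''k''])
                       (RGet ''S'' [IVar ''i'', IVar ''k'', IVar ''k'', IVar ''r'']))
                (RGet ''S'' [IVar ''i'', IVar ''k'', IVar ''k'', IVar ''k''])))))))"

definition gram_prog :: com where
  "gram_prog =
    for_loop ''i'' ''ii'' (for_loop ''k'' ''kk'' (for_loop ''p'' ''pp'' (for_loop ''r'' ''rr''
      (Seq
        (for_loop ''l'' ''ll''
          (RAssign ''G'' [IVar ''i'', IVar ''k'', IVar ''p'', IVar ''r'', IAdd (IVar ''l'') (IConst 1)]
            (RAdd (RGet ''G'' [IVar ''i'', IVar ''k'', IVar ''p'', IVar ''r'', IVar ''l''])
              (RMult (RGet ''S'' [IVar ''i'', IVar ''k'', IVar ''l'', IVar ''k''])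
                     (RGet ''S'' [IVar ''p'', IVar ''r'', IVar ''l'', IVar ''r''])))))
        (RAssign ''L'' [IAdd (IVar ''ii'') (IVar ''k''), IAdd (IVar ''pp'') (IVar ''r'')]
          (RGet ''G'' [IVar ''i'', IVar ''k'', IVar ''p'', IVar ''r'', IVar ''n'']))))))"

definition powers_prog :: com where
  "powers_prog =
    Seq (RAssign ''Q'' [IConst 0] (RConst 1))
      (for_loop ''i'' ''ii''
        (RAssign ''Q'' [IAdd (IVar ''i'') (IConst 1)]
          (RMult (RGet ''Q'' [IVar ''i'']) (RMult base_exp (RMult base_exp base_exp)))))"

definition weights_prog :: com where
  "weights_prog =
    for_loop ''i'' ''ii'' (for_loop ''k'' ''kk''
      (Seq (RAssign ''c'' [IAdd (IVar ''ii'') (IVar ''k'')]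
             (RMult (RGet ''Q'' [IVar ''i''])
               (RAdd (RConst 1) (RMult (RMult base_exp base_exp) (RIndex (IVar ''k''))))))
      (Seq (RAssign ''c'' [IAdd (IVar ''q'') (IAdd (IVar ''ii'') (IVar ''k''))]
             (RMult (RGet ''Q'' [IVar ''i''])
               (RAdd base_exp (RMult (RMult base_exp base_exp)
                 (RIndex (ISub (ISub (IVar ''n'') (IConst 1)) (IVar ''k'')))))))
           (RAssign ''L'' [IAdd (IVar ''q'') (IAdd (IVar ''ii'') (IVar ''k'')),
               IAdd (IVar ''q'') (IAdd (IVar ''ii'') (IVar ''k''))]
             (RDiv (RConst 1) (RGet ''S'' [IVar ''i'', IVar ''k'', IVar ''k'', IVar ''k'']))))))"

definition target_prog :: com where
  "target_prog =
    Seq (for_loop ''i'' ''ii''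
          (RAssign ''T'' [IAdd (IVar ''i'') (IConst 1)]
            (RAdd (RGet ''T'' [IVar ''i''])
              (RMult (RGet ''Q'' [IVar ''i''])
                (RAdd (RAdd (RConst 1) base_exp)
                  (RMult (RMult base_exp base_exp) (RIndex (ISub (IVar ''n'') (IConst 1)))))))))
    (Seq (RAssign ''C'' [] (RGet ''T'' [IVar ''n'']))
         (RAssign ''alpha'' [] (RConst 1)))"

definition reduction :: com where
  "reduction = Seq dimensions_prog (Seq copy_prog (Seq eliminate_prog (Seq gram_prog
     (Seq powers_prog (Seq weights_prog target_prog)))))"

section \<open>Correctness and running time for an arbitrary storage weight\<close>

definition run_time :: "nat \<Rightarrow> nat \<Rightarrow> nat" where
  "run_time n B =
    (let L = loop_time n B in
      n * (3 + 2 * B) + 3 + 2 * B + (L (L (L (1 + B))) + (L (L (L (L (1 + B)))) +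
      (L (L (L (L (L (1 + B) + (1 + B))))) + (1 + B + L (1 + B) + (L (L (3 * (1 + B))) +
      (L (1 + B) + 2 * (1 + B))))))))"

text \<open>Instantiated with weight 0 and \<open>B = 0\<close> for the arithmetic time, and with
  \<open>bit_size\<close> and \<open>bit_bound\<close> for the bit time. The assumptions bound the
  weight of each kind of stored value; the largest index value is \<open>2 * n * n\<close>, stored
  in \<open>m\<close>.\<close>

locale bounded_run =
  fixes w :: "real \<Rightarrow> nat" and B n :: nat and A :: "nat \<Rightarrow> real mat"
  assumes n_pos: "0 < n"
    and w_index: "\<And>v. v \<le> 2 * n * n \<Longrightarrow> w (of_nat v) \<le> B"
    and w_pivoted: "\<And>i k p r. i < n \<Longrightarrow> k \<le> n \<Longrightarrow> p < n \<Longrightarrow> r < n \<Longrightarrow> w (pivoted A i k p r) \<le> B"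
    and w_weight: "\<And>i k. i < n \<Longrightarrow> k < n \<Longrightarrow> w (pivot_weight A i k) \<le> B"
    and w_gram: "\<And>i k p r l. i < n \<Longrightarrow> k < n \<Longrightarrow> p < n \<Longrightarrow> r < n \<Longrightarrow> l \<le> n \<Longrightarrow>
      w (partial_gram A i k p r l) \<le> B"
    and w_power: "\<And>i. i \<le> n \<Longrightarrow> w (real ((cost_base n ^ 3) ^ i)) \<le> B"
    and w_unit: "\<And>a. a < 2 * n * n \<Longrightarrow> w (real (unit_cost n a)) \<le> B"
    and w_target: "\<And>i. i \<le> n \<Longrightarrow> w (real (partial_target n i)) \<le> B"
begin

abbreviation "val \<equiv> cell_value n A"
abbreviation "\<rho> \<equiv> (\<lambda>_. 0)(''n'' := n, ''q'' := n * n, ''m'' := 2 * n * n)"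
abbreviation "lt \<equiv> loop_time n B"

lemma w_index': "v \<le> n * n \<Longrightarrow> w (of_nat v) \<le> B"
  by (rule w_index) linarith

lemmas loop_rules =
  fills_for_loop_indep[where n = n and w = w and B = B, OF _ _ _ _ w_index']
  fills_for_loop[where n = n and w = w and B = B, OF _ _ _ _ w_index']

lemma fills_copy:
  assumes "\<And>i p r. i < n \<Longrightarrow> p < n \<Longrightarrow> r < n \<Longrightarrow> (''A'', [i, p, r]) \<in> D"
  shows "fills w val \<rho> D copy_prog (lt (lt (lt (1 + B))))
    (\<Union>i<n. \<Union>p<n. \<Union>r<n. {(''S'', [i, 0, p, r])})"
  unfolding copy_prog_def
  by (intro loop_rules(1) fills_assign)
    (auto simp: assms cell_value_def pivoted_def intro!: w_pivoted[unfolded pivoted_def, where k = 0, simplified])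

text \<open>Only the outermost loop needs the rule with memory, since stage k + 1 reads nothing but
  stage k.\<close>

lemma fills_eliminate:
  assumes "\<And>i p r. i < n \<Longrightarrow> p < n \<Longrightarrow> r < n \<Longrightarrow> (''S'', [i, 0, p, r]) \<in> D"
  shows "fills w val \<rho> D eliminate_prog (lt (lt (lt (lt (1 + B)))))
    (\<Union>k<n. \<Union>i<n. \<Union>p<n. \<Union>r<n. {(''S'', [i, Suc k, p, r])})"
  unfolding eliminate_prog_def
proof (rule loop_rules(2))
  fix k assume k: "k < n"
  let ?D = "D \<union> (\<Union>j<k. \<Union>i<n. \<Union>p<n. \<Union>r<n. {(''S'', [i, Suc j, p, r])})"
  have mem: "(''S'', [i, k, p, r]) \<in> ?D" if "i < n" "p < n" "r < n" for i p r
    using assms that by (cases k) auto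
  show "fills w val (\<rho>(''k'' := k, ''kk'' := k * n)) ?D
    (for_loop ''i'' ''ii'' (for_loop ''p'' ''pp'' (for_loop ''r'' ''rr''
      (RAssign ''S'' [IVar ''i'', IAdd (IVar ''k'') (IConst 1), IVar ''p'', IVar ''r'']
        (RSub (RGet ''S'' [IVar ''i'', IVar ''k'', IVar ''p'', IVar ''r''])
          (RDiv (RMult (RGet ''S'' [IVar ''i'', IVar ''k'', IVar ''p'', IVar ''k''])
                       (RGet ''S'' [IVar ''i'', IVar ''k'', IVar ''k'', IVar ''r'']))
                (RGet ''S'' [IVar ''i'', IVar ''k'', IVar ''k'', IVar ''k''])))))))
    (lt (lt (lt (1 + B)))) (\<Union>i<n. \<Union>p<n. \<Union>r<n. {(''S'', [i, Suc k, p, r])})"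
  proof (intro loop_rules(1) fills_assign)
    fix i p r assume ipr: "i < n" "p < n" "r < n"
    show "w (val ''S'' [i, Suc k, p, r]) \<le> B"
      using w_pivoted[of i "Suc k" p r] ipr k by (simp add: cell_value_def)
    fix s :: store
    assume s: "idx s = \<rho>(''k'' := k, ''kk'' := k * n, ''i'' := i, ''ii'' := i * n, ''p'' := p,
        ''pp'' := p * n, ''r'' := r, ''rr'' := r * n)"
      and agr: "\<And>y ls. (y, ls) \<in> ?D \<Longrightarrow> arr s y ls = val y ls"
    have "arr s ''S'' [i, k, p, r] = pivoted A i k p r" if "p < n" "r < n" for p r
      using agr[OF mem[OF ipr(1) that]] by (simp add: cell_value_def)
    then show "map (\<lambda>a. ival a s) [IVar ''i'', IAdd (IVar ''k'') (IConst 1), IVar ''p'', IVar ''r'']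
        = [i, Suc k, p, r] \<and>
      rval (RSub (RGet ''S'' [IVar ''i'', IVar ''k'', IVar ''p'', IVar ''r''])
          (RDiv (RMult (RGet ''S'' [IVar ''i'', IVar ''k'', IVar ''p'', IVar ''k''])
                       (RGet ''S'' [IVar ''i'', IVar ''k'', IVar ''k'', IVar ''r'']))
                (RGet ''S'' [IVar ''i'', IVar ''k'', IVar ''k'', IVar ''k'']))) s
        = val ''S'' [i, Suc k, p, r]"
      using s ipr k by (simp add: cell_value_def pivoted_def)
  qed auto
qed auto

lemma block_index:
  assumes "i < n" "k < n"
  shows "i * n + k < n * n" "(i * n + k) div n = i" "(i * n + k) mod n = k"
  using pair_index_less[OF assms] assms(2) by auto

lemma fills_gram:
  assumes S: "\<And>i k p r. i < n \<Longrightarrow> k < n \<Longrightarrow> p < n \<Longrightarrow> r < n \<Longrightarrow> (''S'', [i, k, p, r]) \<in> D"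
    and G: "\<And>i k p r. i < n \<Longrightarrow> k < n \<Longrightarrow> p < n \<Longrightarrow> r < n \<Longrightarrow> (''G'', [i, k, p, r, 0]) \<in> D"
  shows "fills w val \<rho> D gram_prog (lt (lt (lt (lt (lt (1 + B) + (1 + B))))))
    (\<Union>i<n. \<Union>k<n. \<Union>p<n. \<Union>r<n. {(''L'', [i * n + k, p * n + r])})"
  unfolding gram_prog_def
proof (intro loop_rules(1))
  fix i k p r assume lt_n: "i < n" "k < n" "p < n" "r < n"
  let ?\<rho> = "\<rho>(''i'' := i, ''ii'' := i * n, ''k'' := k, ''kk'' := k * n,
    ''p'' := p, ''pp'' := p * n, ''r'' := r, ''rr'' := r * n)"
  let ?g = "RAssign ''G'' [IVar ''i'', IVar ''k'', IVar ''p'', IVar ''r'', IAdd (IVar ''l'') (IConst 1)]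
            (RAdd (RGet ''G'' [IVar ''i'', IVar ''k'', IVar ''p'', IVar ''r'', IVar ''l''])
              (RMult (RGet ''S'' [IVar ''i'', IVar ''k'', IVar ''l'', IVar ''k''])
                     (RGet ''S'' [IVar ''p'', IVar ''r'', IVar ''l'', IVar ''r''])))"
  let ?l = "RAssign ''L'' [IAdd (IVar ''ii'') (IVar ''k''), IAdd (IVar ''pp'') (IVar ''r'')]
          (RGet ''G'' [IVar ''i'', IVar ''k'', IVar ''p'', IVar ''r'', IVar ''n''])"
  let ?E = "\<Union>l<n. {(''G'', [i, k, p, r, Suc l])}"
  have 1: "fills w val ?\<rho> D (for_loop ''l'' ''ll'' ?g) (lt (1 + B)) ?E"
  proof (intro loop_rules(2) fills_assign)
    fix l assume l: "l < n"
    show "w (val ''G'' [i, k, p, r, Suc l]) \<le> B"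
      using w_gram[of i k p r "Suc l"] lt_n l by (simp add: cell_value_def)
    fix s :: store
    assume s: "idx s = ?\<rho>(''l'' := l, ''ll'' := l * n)"
      and agr: "\<And>y ls. (y, ls) \<in> D \<union> (\<Union>j<l. {(''G'', [i, k, p, r, Suc j])}) \<Longrightarrow> arr s y ls = val y ls"
    have "(''G'', [i, k, p, r, l]) \<in> D \<union> (\<Union>j<l. {(''G'', [i, k, p, r, Suc j])})"
      using G lt_n by (cases l) auto
    from agr[OF this] have g: "arr s ''G'' [i, k, p, r, l] = partial_gram A i k p r l"
      by (simp add: cell_value_def)
    have "arr s ''S'' [i, k, l, k] = pivot_column A i k l" "arr s ''S'' [p, r, l, r] = pivot_column A p r l"
      using S lt_n l by (auto simp: agr cell_value_def pivot_column_def)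
    with g s show "map (\<lambda>a. ival a s) [IVar ''i'', IVar ''k'', IVar ''p'', IVar ''r'', IAdd (IVar ''l'') (IConst 1)]
        = [i, k, p, r, Suc l] \<and>
      rval (RAdd (RGet ''G'' [IVar ''i'', IVar ''k'', IVar ''p'', IVar ''r'', IVar ''l''])
              (RMult (RGet ''S'' [IVar ''i'', IVar ''k'', IVar ''l'', IVar ''k''])
                     (RGet ''S'' [IVar ''p'', IVar ''r'', IVar ''l'', IVar ''r'']))) s
        = val ''G'' [i, k, p, r, Suc l]"
      by (simp add: cell_value_def partial_gram_def)
  qed auto
  have eq: "dpp_kernel n (pivot_weight A) (pivot_column A) (i * n + k) (p * n + r) = partial_gram A i k p r n"
    using block_index[OF lt_n(1,2)] block_index[OF lt_n(3,4)] by (simp add: dpp_kernel_def partial_gram_def)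
  have 2: "fills w val ?\<rho> (D \<union> ?E) ?l (1 + B) {(''L'', [i * n + k, p * n + r])}"
  proof (rule fills_assign)
    show "w (val ''L'' [i * n + k, p * n + r]) \<le> B"
      using w_gram[of i k p r n] lt_n by (simp add: cell_value_def eq)
    fix s :: store
    assume s: "idx s = ?\<rho>"
      and agr: "\<And>y ls. (y, ls) \<in> D \<union> ?E \<Longrightarrow> arr s y ls = val y ls"
    \<comment> \<open>The full sum is at index n, filled in the last round l = n - 1.\<close>
    have "(''G'', [i, k, p, r, n]) \<in> D \<union> ?E" using n_pos by (cases n) auto
    from agr[OF this] s show "map (\<lambda>a. ival a s) [IAdd (IVar ''ii'') (IVar ''k''), IAdd (IVar ''pp'') (IVar ''r'')]
        = [i * n + k, p * n + r] \<and>
       rval (RGet ''G'' [IVar ''i'', IVar ''k'', IVar ''p'', IVar ''r'', IVar ''n'']) s = val ''L'' [i * n + k, p * n + r]"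
      by (simp add: cell_value_def eq)
  qed
  show "fills w val ?\<rho> D (Seq (for_loop ''l'' ''ll'' ?g) ?l) (lt (1 + B) + (1 + B))
      {(''L'', [i * n + k, p * n + r])}"
    by (rule fills_weaken[OF fills_Seq[OF 1 2]]) auto
qed auto

lemma rval_base_exp: "idx s ''n'' = n \<Longrightarrow> rval base_exp s = real (cost_base n)"
  by (simp add: base_exp_def cost_base_def)

lemma fills_powers:
  "fills w val \<rho> D powers_prog (1 + B + lt (1 + B)) (\<Union>i<n. {(''Q'', [i])})"
proof -
  let ?E = "\<Union>i<n. {(''Q'', [Suc i])}"
  have 1: "fills w val \<rho> D (RAssign ''Q'' [IConst 0] (RConst 1)) (1 + B) {(''Q'', [0])}"
    using w_power[of 0] by (intro fills_assign) (auto simp: cell_value_def)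
  have 2: "fills w val \<rho> (D \<union> {(''Q'', [0])}) (for_loop ''i'' ''ii''
        (RAssign ''Q'' [IAdd (IVar ''i'') (IConst 1)]
          (RMult (RGet ''Q'' [IVar ''i'']) (RMult base_exp (RMult base_exp base_exp))))) (lt (1 + B)) ?E"
  proof (intro loop_rules(2) fills_assign)
    fix i assume i: "i < n"
    show "w (val ''Q'' [Suc i]) \<le> B" using w_power[of "Suc i"] i by (simp add: cell_value_def)
    fix s :: store
    assume s: "idx s = \<rho>(''i'' := i, ''ii'' := i * n)"
      and agr: "\<And>y ls. (y, ls) \<in> D \<union> {(''Q'', [0])} \<union> (\<Union>j<i. {(''Q'', [Suc j])}) \<Longrightarrow> arr s y ls = val y ls"
    have "(''Q'', [i]) \<in> D \<union> {(''Q'', [0])} \<union> (\<Union>j<i. {(''Q'', [Suc j])})" by (cases i) auto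
    from agr[OF this] s show "map (\<lambda>a. ival a s) [IAdd (IVar ''i'') (IConst 1)] = [Suc i] \<and>
        rval (RMult (RGet ''Q'' [IVar ''i'']) (RMult base_exp (RMult base_exp base_exp))) s = val ''Q'' [Suc i]"
      by (simp add: cell_value_def rval_base_exp power3_eq_cube)
  qed auto
  have "(\<Union>i<n. {(''Q'', [i])}) \<subseteq> {(''Q'', [0])} \<union> ?E"
  proof
    fix c assume "c \<in> (\<Union>i<n. {(''Q'', [i])})"
    then obtain i where "i < n" "c = (''Q'', [i])" by auto
    then show "c \<in> {(''Q'', [0])} \<union> ?E" by (cases i) auto
  qed
  then show ?thesis
    unfolding powers_prog_def by (intro fills_weaken[OF fills_Seq[OF 1 2]]) auto
qed

lemma fills_weights:
  assumes S: "\<And>i k. i < n \<Longrightarrow> k < n \<Longrightarrow> (''S'', [i, k, k, k]) \<in> D"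
    and Q: "\<And>i. i < n \<Longrightarrow> (''Q'', [i]) \<in> D"
  shows "fills w val \<rho> D weights_prog (lt (lt (3 * (1 + B))))
    (\<Union>i<n. \<Union>k<n. {(''c'', [i * n + k]), (''c'', [n * n + (i * n + k)]),
      (''L'', [n * n + (i * n + k), n * n + (i * n + k)])})"
  unfolding weights_prog_def
proof (intro loop_rules(1))
  fix i k assume ik: "i < n" "k < n"
  let ?\<rho> = "\<rho>(''i'' := i, ''ii'' := i * n, ''k'' := k, ''kk'' := k * n)"
  let ?a = "i * n + k"
  have a: "?a < n * n" "?a div n = i" "?a mod n = k" using block_index[OF ik] by auto
  let ?c1 = "RAssign ''c'' [IAdd (IVar ''ii'') (IVar ''k'')]
             (RMult (RGet ''Q'' [IVar ''i''])
               (RAdd (RConst 1) (RMult (RMult base_exp base_exp) (RIndex (IVar ''k'')))))"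
  let ?c2 = "RAssign ''c'' [IAdd (IVar ''q'') (IAdd (IVar ''ii'') (IVar ''k''))]
             (RMult (RGet ''Q'' [IVar ''i''])
               (RAdd base_exp (RMult (RMult base_exp base_exp)
                 (RIndex (ISub (ISub (IVar ''n'') (IConst 1)) (IVar ''k''))))))"
  let ?c3 = "RAssign ''L'' [IAdd (IVar ''q'') (IAdd (IVar ''ii'') (IVar ''k'')),
               IAdd (IVar ''q'') (IAdd (IVar ''ii'') (IVar ''k''))]
             (RDiv (RConst 1) (RGet ''S'' [IVar ''i'', IVar ''k'', IVar ''k'', IVar ''k'']))"
  have wa: "w (real (unit_cost n ?a)) \<le> B" "w (real (unit_cost n (n * n + ?a))) \<le> B"
    using a(1) by (auto intro!: w_unit)
  have 1: "fills w val ?\<rho> D' ?c1 (1 + B) {(''c'', [?a])}" if "D \<subseteq> D'" for D'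
    using wa(1) ik a that Q
    by (intro fills_assign)
      (auto simp: cell_value_def rval_base_exp unit_cost_def power2_eq_square subset_iff distrib_left)
  have 2: "fills w val ?\<rho> D' ?c2 (1 + B) {(''c'', [n * n + ?a])}" if "D \<subseteq> D'" for D'
    using wa(2) ik a that Q
    by (intro fills_assign)
      (auto simp: cell_value_def rval_base_exp unit_cost_def power2_eq_square subset_iff distrib_left)
  have 3: "fills w val ?\<rho> D' ?c3 (1 + B) {(''L'', [n * n + ?a, n * n + ?a])}" if "D \<subseteq> D'" for D'
    using w_weight[OF ik] ik a that S
    by (intro fills_assign)
      (auto simp: cell_value_def dpp_kernel_def pivot_weight_def subset_iff)
  show "fills w val ?\<rho> D (Seq ?c1 (Seq ?c2 ?c3)) (3 * (1 + B))
    {(''c'', [?a]), (''c'', [n * n + ?a]), (''L'', [n * n + ?a, n * n + ?a])}"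
    by (rule fills_weaken[OF fills_Seq[OF 1 fills_Seq[OF 2 3]]]) auto
qed auto

lemma fills_target:
  assumes T: "(''T'', [0]) \<in> D" and Q: "\<And>i. i < n \<Longrightarrow> (''Q'', [i]) \<in> D"
  shows "fills w val \<rho> D target_prog (lt (1 + B) + 2 * (1 + B)) {(''C'', []), (''alpha'', [])}"
proof -
  let ?E = "\<Union>i<n. {(''T'', [Suc i])}"
  let ?P = "for_loop ''i'' ''ii''
          (RAssign ''T'' [IAdd (IVar ''i'') (IConst 1)]
            (RAdd (RGet ''T'' [IVar ''i''])
              (RMult (RGet ''Q'' [IVar ''i''])
                (RAdd (RAdd (RConst 1) base_exp)
                  (RMult (RMult base_exp base_exp) (RIndex (ISub (IVar ''n'') (IConst 1))))))))"
  have 1: "fills w val \<rho> D ?P (lt (1 + B)) ?E"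
  proof (intro loop_rules(2) fills_assign)
    fix i assume i: "i < n"
    show "w (val ''T'' [Suc i]) \<le> B" using w_target[of "Suc i"] i by (simp add: cell_value_def)
    fix s :: store
    assume s: "idx s = \<rho>(''i'' := i, ''ii'' := i * n)"
      and agr: "\<And>y ls. (y, ls) \<in> D \<union> (\<Union>j<i. {(''T'', [Suc j])}) \<Longrightarrow> arr s y ls = val y ls"
    have "(''T'', [i]) \<in> D \<union> (\<Union>j<i. {(''T'', [Suc j])})" using T by (cases i) auto
    from agr[OF this] have "arr s ''T'' [i] = real (partial_target n i)" by (simp add: cell_value_def)
    moreover have "arr s ''Q'' [i] = real ((cost_base n ^ 3) ^ i)"
      using agr[of "''Q''" "[i]"] Q[OF i] by (simp add: cell_value_def)
    ultimately show "map (\<lambda>a. ival a s) [IAdd (IVar ''i'') (IConst 1)] = [Suc i] \<and>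
        rval (RAdd (RGet ''T'' [IVar ''i''])
              (RMult (RGet ''Q'' [IVar ''i''])
                (RAdd (RAdd (RConst 1) base_exp)
                  (RMult (RMult base_exp base_exp) (RIndex (ISub (IVar ''n'') (IConst 1))))))) s = val ''T'' [Suc i]"
      using s by (simp add: cell_value_def rval_base_exp partial_target_def power2_eq_square distrib_left)
  qed auto
  have n: "(''T'', [n]) \<in> ?E" using n_pos by (cases n) auto
  have C: "partial_target n n = target_cost n" by (simp add: partial_target_def target_cost_def)
  have 2: "fills w val \<rho> (D \<union> ?E) (RAssign ''C'' [] (RGet ''T'' [IVar ''n''])) (1 + B) {(''C'', [])}"
    using w_target[of n] n by (intro fills_assign) (auto simp: cell_value_def C)
  have 3: "fills w val \<rho> D' (RAssign ''alpha'' [] (RConst 1)) (1 + B) {(''alpha'', [])}" for D'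
    using w_power[of 0] by (intro fills_assign) (auto simp: cell_value_def)
  show ?thesis
    unfolding target_prog_def
    by (rule fills_weaken[OF fills_Seq[OF 1 fills_Seq[OF 2 3]]]) auto
qed

text \<open>Handled outside \<open>fills\<close>, because this part changes the index variables
  \<open>q\<close> and \<open>m\<close> for good. The product \<open>n * n\<close> is obtained by
  repeated addition.\<close>

lemma run_dimensions:
  "\<exists>t s. exec w dimensions_prog (input_store n A) t s \<and> t \<le> n * (3 + 2 * B) + 3 + 2 * B \<and>
    idx s = \<rho> \<and> arr s = arr (input_store n A)"
proof -
  let ?P = "Seq (IAssign ''q'' (IAdd (IVar ''q'') (IVar ''n''))) (IAssign ''i'' (IAdd (IVar ''i'') (IConst 1)))"
  let ?W = "While (ILess (IVar ''i'') (IVar ''n'')) ?P"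
  have loop: "\<exists>t s'. exec w ?W s t s' \<and> t \<le> (n - k) * (3 + 2 * B) + 1 \<and>
      idx s' = (\<lambda>_. 0)(''n'' := n, ''q'' := n * n, ''i'' := n) \<and> arr s' = arr s"
    if "k \<le> n" "idx s = (\<lambda>_. 0)(''n'' := n, ''q'' := k * n, ''i'' := k)" for k s
    using that
  proof (induction "n - k" arbitrary: k s)
    case 0
    then have "\<not> bval (ILess (IVar ''i'') (IVar ''n'')) s" "k = n" by simp_all
    from exec.WhileFalse[OF this(1)] this(2) show ?case using 0 by (intro exI conjI) auto
  next
    case (Suc m)
    then have k: "k < n" by simp
    define s1 where "s1 = set_idx ''q'' (Suc k * n) s"
    define s2 where "s2 = set_idx ''i'' (Suc k) s1"
    have wk: "w (of_nat (Suc k)) \<le> B" "w (of_nat (Suc k * n)) \<le> B"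
      using k by (intro w_index'; metis Suc_leI le_square le_trans mult_le_mono1)+
    have "exec w (IAssign ''q'' (IAdd (IVar ''q'') (IVar ''n''))) s (1 + w (of_nat (Suc k * n))) s1"
      using exec.IAssign[of w "''q''" "IAdd (IVar ''q'') (IVar ''n'')" s] Suc.prems(2)
      by (simp add: s1_def add.commute)
    moreover have "exec w (IAssign ''i'' (IAdd (IVar ''i'') (IConst 1))) s1 (1 + w (of_nat (Suc k))) s2"
      using exec.IAssign[of w "''i''" "IAdd (IVar ''i'') (IConst 1)" s1] Suc.prems(2)
      by (simp add: s1_def s2_def set_idx_def)
    ultimately have step: "exec w ?P s ((1 + w (of_nat (Suc k * n))) + (1 + w (of_nat (Suc k)))) s2"
      by (rule exec.Seq)
    have idx2: "idx s2 = (\<lambda>_. 0)(''n'' := n, ''q'' := Suc k * n, ''i'' := Suc k)"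
      using Suc.prems(2) by (auto simp: s1_def s2_def set_idx_def fun_eq_iff)
    have "m = n - Suc k" "Suc k \<le> n" using Suc.hyps(2) k by auto
    from Suc.hyps(1)[OF this idx2] obtain t' s' where 2: "exec w ?W s2 t' s'"
      "t' \<le> (n - Suc k) * (3 + 2 * B) + 1"
      "idx s' = (\<lambda>_. 0)(''n'' := n, ''q'' := n * n, ''i'' := n)" "arr s' = arr s2"
      by blast
    have "bval (ILess (IVar ''i'') (IVar ''n'')) s" using Suc.prems(2) k by simp
    from exec.WhileTrue[OF this step 2(1)]
    have run: "exec w ?W s (1 + ((1 + w (of_nat (Suc k * n))) + (1 + w (of_nat (Suc k)))) + t') s'" .
    have "n - k = Suc (n - Suc k)" using k by simp
    then have "1 + ((1 + w (of_nat (Suc k * n))) + (1 + w (of_nat (Suc k)))) + t' \<le> (n - k) * (3 + 2 * B) + 1"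
      using 2(2) wk by simp
    moreover have "arr s' = arr s" using 2(4) by (simp add: s1_def s2_def set_idx_def)
    ultimately show ?case using run 2(3) by blast
  qed
  have "idx (input_store n A) = (\<lambda>_. 0)(''n'' := n, ''q'' := 0 * n, ''i'' := 0)"
    by (auto simp: input_store_def fun_eq_iff)
  from loop[OF _ this] obtain t s where 1: "exec w ?W (input_store n A) t s" "t \<le> n * (3 + 2 * B) + 1"
    "idx s = (\<lambda>_. 0)(''n'' := n, ''q'' := n * n, ''i'' := n)" "arr s = arr (input_store n A)"
    by auto
  define s1 where "s1 = set_idx ''i'' 0 s"
  define s2 where "s2 = set_idx ''m'' (2 * n * n) s1"
  have "exec w (IAssign ''i'' (IConst 0)) s (1 + w (of_nat 0)) s1"
    using exec.IAssign[of w "''i''" "IConst 0" s] by (simp add: s1_def)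
  moreover have "exec w (IAssign ''m'' (IAdd (IVar ''q'') (IVar ''q''))) s1 (1 + w (of_nat (2 * n * n))) s2"
  proof -
    have "ival (IAdd (IVar ''q'') (IVar ''q'')) s1 = 2 * n * n"
      using 1(3) by (simp add: s1_def set_idx_def)
    then show ?thesis
      using exec.IAssign[of w "''m''" "IAdd (IVar ''q'') (IVar ''q'')" s1] unfolding s2_def by metis
  qed
  ultimately have "exec w dimensions_prog (input_store n A)
      (t + ((1 + w (of_nat 0)) + (1 + w (of_nat (2 * n * n))))) s2"
    using 1(1) unfolding dimensions_prog_def by (intro exec.Seq)
  moreover have "t + ((1 + w (of_nat 0)) + (1 + w (of_nat (2 * n * n)))) \<le> n * (3 + 2 * B) + 3 + 2 * B"
    using 1(2) w_index[of 0] w_index[of "2 * n * n"] by simp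
  moreover have "idx s2 = \<rho>" "arr s2 = arr (input_store n A)"
    using 1(3,4) by (auto simp: s1_def s2_def set_idx_def fun_eq_iff)
  ultimately show ?thesis by blast
qed

lemma run_reduction:
  "\<exists>t s. exec w reduction (input_store n A) t s \<and> t \<le> run_time n B \<and>
    output_store s (2 * n * n) (kernel_mat n (pivot_weight A) (pivot_column A)) (cost_vec n)
      (int (target_cost n)) 1"
proof -
  \<comment> \<open>Besides the input this contains the zeros from which the recurrences in
    \<open>G\<close> and \<open>T\<close> start.\<close>
  let ?D = "{(x, js). arr (input_store n A) x js = val x js}"
  let ?E1 = "\<Union>i<n. \<Union>p<n. \<Union>r<n. {(''S'', [i, 0, p, r])}"
  let ?E2 = "\<Union>k<n. \<Union>i<n. \<Union>p<n. \<Union>r<n. {(''S'', [i, Suc k, p, r])}"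
  let ?E3 = "\<Union>i<n. \<Union>k<n. \<Union>p<n. \<Union>r<n. {(''L'', [i * n + k, p * n + r])}"
  let ?E4 = "\<Union>i<n. {(''Q'', [i])}"
  let ?E5 = "\<Union>i<n. \<Union>k<n. {(''c'', [i * n + k]), (''c'', [n * n + (i * n + k)]),
      (''L'', [n * n + (i * n + k), n * n + (i * n + k)])}"
  let ?E6 = "{(''C'', []), (''alpha'', [])}"
  have S: "(''S'', [i, k, p, r]) \<in> ?E1 \<union> ?E2" if "i < n" "k < n" "p < n" "r < n" for i k p r
    using that by (cases k) auto
  have 1: "fills w val \<rho> ?D copy_prog (lt (lt (lt (1 + B)))) ?E1"
    by (rule fills_copy) (auto simp: input_store_def cell_value_def)
  have 2: "fills w val \<rho> (?D \<union> ?E1) eliminate_prog (lt (lt (lt (lt (1 + B))))) ?E2"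
    by (rule fills_eliminate) auto
  have 3: "fills w val \<rho> (?D \<union> ?E1 \<union> ?E2) gram_prog (lt (lt (lt (lt (lt (1 + B) + (1 + B)))))) ?E3"
    using S by (intro fills_gram) (auto simp: input_store_def cell_value_def partial_gram_def)
  have 4: "fills w val \<rho> (?D \<union> ?E1 \<union> ?E2 \<union> ?E3) powers_prog (1 + B + lt (1 + B)) ?E4"
    by (rule fills_powers)
  have 5: "fills w val \<rho> (?D \<union> ?E1 \<union> ?E2 \<union> ?E3 \<union> ?E4) weights_prog (lt (lt (3 * (1 + B)))) ?E5"
    using S by (intro fills_weights) auto
  have 6: "fills w val \<rho> (?D \<union> ?E1 \<union> ?E2 \<union> ?E3 \<union> ?E4 \<union> ?E5) target_prog
      (lt (1 + B) + 2 * (1 + B)) ?E6"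
    by (intro fills_target) (auto simp: input_store_def cell_value_def partial_target_def)
  obtain t s where d: "exec w dimensions_prog (input_store n A) t s" "t \<le> n * (3 + 2 * B) + 3 + 2 * B"
    "idx s = \<rho>" "arr s = arr (input_store n A)"
    using run_dimensions by blast
  have start: "agree val ?D s" using d(4) by (auto simp: agree_def)
  obtain t' s' where r: "exec w (Seq copy_prog (Seq eliminate_prog (Seq gram_prog
      (Seq powers_prog (Seq weights_prog target_prog))))) s t' s'"
    "t' \<le> lt (lt (lt (1 + B))) + (lt (lt (lt (lt (1 + B)))) +
      (lt (lt (lt (lt (lt (1 + B) + (1 + B))))) + (1 + B + lt (1 + B) + (lt (lt (3 * (1 + B))) +
      (lt (1 + B) + 2 * (1 + B))))))"
    "idx s' = \<rho>" "\<forall>x js. arr s x js = val x js \<longrightarrow> arr s' x js = val x js"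
    "agree val (?E1 \<union> (?E2 \<union> (?E3 \<union> (?E4 \<union> (?E5 \<union> ?E6))))) s'"
    by (rule fills_run[OF fills_Seq[OF 1 fills_Seq[OF 2 fills_Seq[OF 3 fills_Seq[OF 4
      fills_Seq[OF 5 6]]]]] d(3) start])
  have run: "exec w reduction (input_store n A) (t + t') s'"
    unfolding reduction_def by (rule exec.Seq[OF d(1) r(1)])
  have time: "t + t' \<le> run_time n B"
    unfolding run_time_def Let_def using d(2) r(2) by linarith
  have "agree val (?E3 \<union> ?E5 \<union> ?E6) s'" using r(5) by (simp only: agree_Un)
  note E = agreeD[OF this]
  have L: "arr s' ''L'' [a, b] = dpp_kernel n (pivot_weight A) (pivot_column A) a b"
    if ab: "a < 2 * n * n" "b < 2 * n * n" for a b
  proof (cases "(''L'', [a, b]) \<in> ?E3 \<union> ?E5")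
    case True
    then show ?thesis using E[of "''L''" "[a, b]"] by (simp add: cell_value_def)
  next
    case False
    \<comment> \<open>A cell of \<open>L\<close> that no loop fills lies outside the Gram block and
      off the diagonal, where the initial 0 is already the right entry.\<close>
    have "dpp_kernel n (pivot_weight A) (pivot_column A) a b = 0"
      using ab(1)
    proof (cases rule: index_cases)
      case a: (1 i k)
      from ab(2) show ?thesis
      proof (cases rule: index_cases)
        case (1 p r)
        then show ?thesis using a False by blast
      next
        case (2 p r)
        then show ?thesis using a(3) pair_index_less[OF a(1,2)] by (simp add: dpp_kernel_def)
      qed
    next
      case (2 i k)
      then show ?thesis using False by (auto simp: dpp_kernel_def)
    qed
    moreover from this have "arr s' ''L'' [a, b] = val ''L'' [a, b]"
      using r(4) d(4) by (auto simp: input_store_def cell_value_def)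
    ultimately show ?thesis by (simp add: cell_value_def)
  qed
  have c: "arr s' ''c'' [a] = real (unit_cost n a)" if a: "a < 2 * n * n" for a
  proof -
    have "(''c'', [a]) \<in> ?E5" using a by (cases rule: index_cases) blast+
    then show ?thesis using E[of "''c''" "[a]"] by (simp add: cell_value_def)
  qed
  have "output_store s' (2 * n * n) (kernel_mat n (pivot_weight A) (pivot_column A)) (cost_vec n)
      (int (target_cost n)) 1"
    unfolding output_store_def
  proof (intro conjI)
    show "idx s' ''m'' = 2 * n * n" using r(3) by simp
    show "kernel_mat n (pivot_weight A) (pivot_column A) =
        mat (2 * n * n) (2 * n * n) (\<lambda>(i, j). arr s' ''L'' [i, j])"
      unfolding kernel_mat_def by (intro eq_matI) (auto simp: L)
    show "cost_vec n \<in> carrier_vec (2 * n * n)" by (simp add: cost_vec_def)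
    show "\<forall>i<2 * n * n. arr s' ''c'' [i] = real_of_int (cost_vec n $ i)"
      by (simp add: c cost_vec_def)
    show "arr s' ''C'' [] = real_of_int (int (target_cost n))" "arr s' ''alpha'' [] = 1"
      using E[of "''C''" "[]"] E[of "''alpha''" "[]"] by (auto simp: cell_value_def)
  qed
  with run time show ?thesis by blast
qed

end

section \<open>Polynomial bounds\<close>

definition poly_bounded :: "(nat \<Rightarrow> nat) \<Rightarrow> bool" where
  "poly_bounded f \<longleftrightarrow> (\<exists>p :: nat poly. \<forall>n. f n \<le> poly p n)"

lemma poly_bounded_const: "poly_bounded (\<lambda>_. c)"
  unfolding poly_bounded_def by (rule exI[of _ "[:c:]"]) simp

lemma poly_bounded_id: "poly_bounded (\<lambda>n. n)"
  unfolding poly_bounded_def by (rule exI[of _ "[:0, 1:]"]) simp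

lemma poly_bounded_add: "poly_bounded f \<Longrightarrow> poly_bounded g \<Longrightarrow> poly_bounded (\<lambda>n. f n + g n)"
  unfolding poly_bounded_def by (metis add_mono poly_add)

lemma poly_bounded_mult: "poly_bounded f \<Longrightarrow> poly_bounded g \<Longrightarrow> poly_bounded (\<lambda>n. f n * g n)"
  unfolding poly_bounded_def by (metis mult_le_mono poly_mult)

lemmas poly_bounded_intros =
  poly_bounded_const poly_bounded_id poly_bounded_add poly_bounded_mult

text \<open>The loops nest to a fixed depth, so unfolding leaves a fixed expression in sums and
  products.\<close>

lemma poly_bounded_run_time: "poly_bounded b \<Longrightarrow> poly_bounded (\<lambda>t. run_time t (b t))"
  unfolding run_time_def loop_time_def Let_def by (intro poly_bounded_intros)

lemma loop_time_mono: "n \<le> n' \<Longrightarrow> T \<le> T' \<Longrightarrow> loop_time n B T \<le> loop_time n' B T'"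
  unfolding loop_time_def by (intro add_mono mult_le_mono) auto

lemma run_time_mono: "n \<le> n' \<Longrightarrow> run_time n B \<le> run_time n' B"
  unfolding run_time_def Let_def
  by (intro add_mono mult_le_mono loop_time_mono order_refl) auto

section \<open>Binary length of the stored values\<close>

lemma base_pos: "0 < real (cost_base n)"
  by (simp only: of_nat_0_less_iff) (simp add: cost_base_def)

lemma base_le_two_power: "cost_base n \<le> 2 ^ (2 * n)"
proof -
  have "Suc n \<le> 2 ^ n" by (rule Suc_leI) (rule less_exp)
  then have "Suc n * Suc n \<le> 2 ^ n * 2 ^ n" by (intro mult_le_mono)
  then show ?thesis by (simp add: cost_base_def mult_2 power_add)
qed

lemma power_base_le_two_power: "(cost_base n ^ 3) ^ n \<le> 2 ^ (6 * n * n)"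
proof -
  have "(cost_base n ^ 3) ^ n \<le> ((2 ^ (2 * n)) ^ 3) ^ n"
    by (intro power_mono base_le_two_power) auto
  also have "\<dots> = 2 ^ (6 * n * n)" by (simp add: power_mult[symmetric] mult_ac)
  finally show ?thesis .
qed

text \<open>The exponent from \<open>schur_rational\<close> when the integer data are bounded by
  \<open>2 ^ (2 * t)\<close>, as \<open>common_denominator\<close> provides, and t also bounds the
  dimension.\<close>

definition height :: "nat \<Rightarrow> nat" where
  "height t = Suc t * Suc t + Suc t * (2 * t) + 2 * t"

text \<open>The sum of the two largest demands: \<open>5 * height t + 2\<close> for the partial Gram
  sums and \<open>6 * t * t + 2\<close> for the costs.\<close>

definition bit_bound :: "nat \<Rightarrow> nat" where
  "bit_bound t = 5 * height t + 6 * t * t + 4"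

lemma height_ge: "2 * t * t \<le> height t" "t \<le> height t"
  by (auto simp: height_def algebra_simps)

lemma pivoted_rational:
  assumes "rational_input n A" "i < n" "k \<le> n"
  shows "\<exists>D::int. D \<noteq> 0 \<and> \<bar>D\<bar> \<le> 2 ^ height (input_bits n A) \<and>
    (\<forall>p<n. \<forall>r<n. \<exists>x::int. \<bar>x\<bar> \<le> 2 ^ height (input_bits n A) \<and>
      pivoted A i k p r = of_int x / of_int D)"
proof -
  let ?t = "input_bits n A"
  let ?T = "{..<n} \<times> {..<n}"
  let ?x = "\<lambda>(p, r). A i $$ (p, r)"
  define \<tau> where "\<tau> = (\<Sum>j\<in>?T. bit_size (?x j))"
  have "\<tau> = (\<Sum>p<n. \<Sum>r<n. bit_size (A i $$ (p, r)))"
    by (simp add: \<tau>_def sum.cartesian_product case_prod_unfold)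
  also have "\<dots> \<le> (\<Sum>i<n. \<Sum>p<n. \<Sum>r<n. bit_size (A i $$ (p, r)))"
    using assms(2) by (intro member_le_sum) auto
  finally have \<tau>: "\<tau> \<le> ?t" by (simp add: input_bits_def)
  have n: "n \<le> ?t" by (simp add: input_bits_def)
  have "?x j \<in> \<rat>" if "j \<in> ?T" for j
    using assms(1,2) that by (auto simp: rational_input_def)
  from common_denominator[of ?T ?x, OF _ this, folded \<tau>_def]
  obtain N b where N: "0 < N" "N \<le> 2 ^ \<tau>"
    and b: "\<And>j. j \<in> ?T \<Longrightarrow> ?x j = of_int (b j) / of_nat N \<and> \<bar>b j\<bar> \<le> 2 ^ (2 * \<tau>)"
    by auto
  let ?h = "Suc n * Suc n + Suc n * (2 * \<tau>) + 2 * \<tau>"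
  have h: "(2::int) ^ ?h \<le> 2 ^ height ?t"
    unfolding height_def using \<tau> n by (intro power_increasing add_mono mult_le_mono) auto
  have "\<exists>D::int. D \<noteq> 0 \<and> \<bar>D\<bar> \<le> 2 ^ ?h \<and> (\<forall>p<n. \<forall>r<n. \<exists>x::int. \<bar>x\<bar> \<le> 2 ^ ?h \<and>
      pivoted A i k p r = of_int x / of_int D)"
    unfolding pivoted_def
  proof (rule schur_rational[where B = "\<lambda>p r. b (p, r)"])
    have "(2::nat) ^ \<tau> \<le> 2 ^ (2 * \<tau>)" by (intro power_increasing) auto
    then show "N \<le> 2 ^ (2 * \<tau>)" using N(2) by linarith
  qed (use N b assms(3) in force)+
  then show ?thesis using h by (meson order_trans)
qed

text \<open>The point is the order of quantifiers: one denominator for a whole column, so that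
  summing products of entries does not multiply denominators.\<close>

lemma pivot_column_rational:
  assumes "rational_input n A" "i < n" "k < n"
  shows "\<exists>(D::int) x. D \<noteq> 0 \<and> \<bar>D\<bar> \<le> 2 ^ height (input_bits n A) \<and>
    (\<forall>l<n. \<bar>x l\<bar> \<le> (2::int) ^ height (input_bits n A) \<and>
      pivot_column A i k l = of_int (x l) / of_int D)"
proof -
  obtain D :: int where D: "D \<noteq> 0" "\<bar>D\<bar> \<le> 2 ^ height (input_bits n A)"
    "\<forall>p<n. \<forall>r<n. \<exists>x::int. \<bar>x\<bar> \<le> 2 ^ height (input_bits n A) \<and>
      pivoted A i k p r = of_int x / of_int D"
    using pivoted_rational[OF assms(1,2) less_imp_le[OF assms(3)]] by blast
  then have "\<forall>l. \<exists>x::int. l < n \<longrightarrow> \<bar>x\<bar> \<le> 2 ^ height (input_bits n A) \<and>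
      pivot_column A i k l = of_int x / of_int D"
    using assms(3) by (auto simp: pivot_column_def)
  from choice[OF this] show ?thesis using D(1,2) by blast
qed

lemma bounded_run_bits:
  assumes "0 < n" "rational_input n A"
  shows "bounded_run bit_size (bit_bound (input_bits n A)) n A"
proof
  let ?t = "input_bits n A"
  let ?h = "height ?t"
  have nt: "n \<le> ?t" by (simp add: input_bits_def)
  then have nn: "n * n \<le> ?t * ?t" by (intro mult_le_mono)
  show "0 < n" by fact
  show "bit_size (of_nat v) \<le> bit_bound ?t" if "v \<le> 2 * n * n" for v
  proof -
    have "v \<le> ?h" using that nn height_ge(1)[of ?t] by simp
    also have "?h \<le> 2 ^ ?h" by (rule less_imp_le[OF less_exp])
    finally have "bit_size (of_nat v) \<le> ?h + 2" by (rule bit_size_of_nat_le)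
    then show ?thesis by (simp add: bit_bound_def)
  qed
  have cost_bits: "bit_size (real v) \<le> bit_bound ?t" if "v \<le> (cost_base n ^ 3) ^ n" for v
  proof -
    have "v \<le> 2 ^ (6 * n * n)" using that power_base_le_two_power by (rule le_trans)
    then have "bit_size (of_nat v) \<le> 6 * n * n + 2" by (rule bit_size_of_nat_le)
    then show ?thesis using nn by (simp add: bit_bound_def)
  qed
  show "bit_size (real ((cost_base n ^ 3) ^ i)) \<le> bit_bound ?t" if "i \<le> n" for i
    using that by (intro cost_bits power_increasing) (auto simp: cost_base_def)
  show "bit_size (real (unit_cost n a)) \<le> bit_bound ?t" if "a < 2 * n * n" for a
  proof (rule cost_bits)
    have "unit_cost n a \<le> (\<Sum>a<2 * n * n. unit_cost n a)" using that by (intro member_le_sum) auto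
    then show "unit_cost n a \<le> (cost_base n ^ 3) ^ n" using total_unit_cost_less[of n] by simp
  qed
  show "bit_size (real (partial_target n i)) \<le> bit_bound ?t" if "i \<le> n" for i
  proof (rule cost_bits)
    have "partial_target n i \<le> partial_target n n"
      unfolding partial_target_def using that by (intro sum_mono2) auto
    also have "\<dots> < (cost_base n ^ 3) ^ n"
      unfolding partial_target_def using target_digit_less[OF assms(1)] by (intro sum_digits_less) auto
    finally show "partial_target n i \<le> (cost_base n ^ 3) ^ n" by simp
  qed
  show "bit_size (pivoted A i k p r) \<le> bit_bound ?t"
    if lt_n: "i < n" "k \<le> n" "p < n" "r < n" for i k p r
  proof -
    obtain x D :: int where "D \<noteq> 0" "\<bar>D\<bar> \<le> 2 ^ ?h" "\<bar>x\<bar> \<le> 2 ^ ?h" "pivoted A i k p r = of_int x / of_int D"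
      using pivoted_rational[OF assms(2) lt_n(1,2)] lt_n(3,4) by blast
    then show ?thesis using bit_size_le[of D x ?h ?h] by (simp add: bit_bound_def)
  qed
  show "bit_size (pivot_weight A i k) \<le> bit_bound ?t" if ik: "i < n" "k < n" for i k
  proof -
    obtain x D :: int where D: "D \<noteq> 0" "\<bar>D\<bar> \<le> 2 ^ ?h" "\<bar>x\<bar> \<le> 2 ^ ?h" "pivoted A i k k k = of_int x / of_int D"
      using pivoted_rational[OF assms(2) ik(1), of k] ik(2) by (meson less_imp_le)
    show ?thesis
    \<comment> \<open>A zero pivot has weight \<open>1 / 0 = 0\<close>; any other pivot has the
      inverted fraction as its weight.\<close>
    proof (cases "x = 0")
      case True
      then show ?thesis using D(4) bit_size_of_int_le[of 0 0] by (simp add: pivot_weight_def bit_bound_def)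
    next
      case False
      then show ?thesis using D bit_size_le[of x D ?h ?h] by (simp add: pivot_weight_def bit_bound_def)
    qed
  qed
  show "bit_size (partial_gram A i k p r l) \<le> bit_bound ?t"
    if lt_n: "i < n" "k < n" "p < n" "r < n" "l \<le> n" for i k p r l
  proof -
    obtain D x where D: "D \<noteq> 0" "\<bar>D\<bar> \<le> 2 ^ ?h"
      and x: "\<And>l. l < n \<Longrightarrow> \<bar>x l\<bar> \<le> (2::int) ^ ?h \<and> pivot_column A i k l = of_int (x l) / of_int D"
      using pivot_column_rational[OF assms(2) lt_n(1,2)] by metis
    obtain D' y where D': "D' \<noteq> 0" "\<bar>D'\<bar> \<le> 2 ^ ?h"
      and y: "\<And>l. l < n \<Longrightarrow> \<bar>y l\<bar> \<le> (2::int) ^ ?h \<and> pivot_column A p r l = of_int (y l) / of_int D'"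
      using pivot_column_rational[OF assms(2) lt_n(3,4)] by metis
    have "partial_gram A i k p r l = of_int (\<Sum>l'<l. x l' * y l') / of_int (D * D')"
      using x y lt_n(5) by (simp add: partial_gram_def sum_divide_distrib)
    \<comment> \<open>The numerator is bounded by three factors \<open>2 ^ ?h\<close>, two for a
      product of entries and one for the number of terms; the denominator by two.\<close>
    moreover have "bit_size (of_int (\<Sum>l'<l. x l' * y l') / of_int (D * D')) \<le> 3 * ?h + 2 * ?h + 2"
    proof (rule bit_size_le)
      show "D * D' \<noteq> 0" using D D' by simp
      have "\<bar>D * D'\<bar> \<le> 2 ^ ?h * 2 ^ ?h" unfolding abs_mult using D D' by (intro mult_mono) auto
      then show "\<bar>D * D'\<bar> \<le> 2 ^ (2 * ?h)" by (simp add: mult_2 power_add)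
      have "\<bar>\<Sum>l'<l. x l' * y l'\<bar> \<le> (\<Sum>l'<l. \<bar>x l' * y l'\<bar>)" by (rule sum_abs)
      also have "\<dots> \<le> (\<Sum>l'<l. 2 ^ ?h * 2 ^ ?h)"
        unfolding abs_mult using x y lt_n(5) by (intro sum_mono mult_mono) auto
      also have "\<dots> = int l * (2 ^ ?h * 2 ^ ?h)" by simp
      also have "\<dots> \<le> 2 ^ ?h * (2 ^ ?h * 2 ^ ?h)"
      proof (intro mult_right_mono int_le_two_power)
        have "l \<le> ?h" using lt_n(5) nt height_ge(2)[of ?t] by simp
        also have "?h \<le> 2 ^ ?h" by (rule less_imp_le[OF less_exp])
        finally show "l \<le> 2 ^ ?h" .
      qed simp
      also have "\<dots> = 2 ^ (3 * ?h)" by (simp add: power_add[symmetric])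
      finally show "\<bar>\<Sum>l'<l. x l' * y l'\<bar> \<le> 2 ^ (3 * ?h)" .
    qed
    ultimately show ?thesis by (simp add: bit_bound_def)
  qed
qed

text \<open>The arithmetic bound also has to pay for the announced dimension
  \<open>2 * n * n\<close>. In the bit bound n is replaced by \<open>input_bits n A\<close>, which
  has n as a summand, so that a polynomial in one variable remains.\<close>

lemma poly_time_reduction: "poly_time reduction {(n, A). 1 \<le> n \<and> (\<forall>i<n. psd n (A i))}"
proof -
  have "poly_bounded (\<lambda>n. run_time n 0 + 2 * n * n)"
    by (intro poly_bounded_intros poly_bounded_run_time)
  then obtain p :: "nat poly" where p: "\<And>n. run_time n 0 + 2 * n * n \<le> poly p n"
    unfolding poly_bounded_def by blast
  have "poly_bounded (\<lambda>t. run_time t (bit_bound t))"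
    unfolding bit_bound_def height_def Suc_eq_plus1 by (intro poly_bounded_intros poly_bounded_run_time)
  then obtain q :: "nat poly" where q: "\<And>t. run_time t (bit_bound t) \<le> poly q t"
    unfolding poly_bounded_def by blast
  have "\<exists>t s. exec (\<lambda>_. 0) reduction (input_store n A) t s \<and> t + idx s ''m'' \<le> poly p n" if "1 \<le> n" for n A
  proof -
    interpret bounded_run "\<lambda>_. 0" 0 n A using that by unfold_locales auto
    obtain t s where "exec (\<lambda>_. 0) reduction (input_store n A) t s" "t \<le> run_time n 0"
      "idx s ''m'' = 2 * n * n"
      using run_reduction by (auto simp: output_store_def)
    then show ?thesis using p[of n] by (intro exI conjI) auto
  qed
  moreover have "\<exists>t s. exec bit_size reduction (input_store n A) t s \<and> t \<le> poly q (input_bits n A)"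
    if "1 \<le> n" "rational_input n A" for n A
  proof -
    interpret bounded_run bit_size "bit_bound (input_bits n A)" n A
      using that by (intro bounded_run_bits) auto
    obtain t s where "exec bit_size reduction (input_store n A) t s"
      "t \<le> run_time n (bit_bound (input_bits n A))"
      using run_reduction by auto
    moreover have "run_time n (bit_bound (input_bits n A)) \<le> run_time (input_bits n A) (bit_bound (input_bits n A))"
      by (rule run_time_mono) (simp add: input_bits_def)
    ultimately show ?thesis using q[of "input_bits n A"] by (meson le_trans)
  qed
  ultimately show ?thesis
    unfolding poly_time_def by - (rule conjI, rule exI[of _ p], auto, rule exI[of _ q], auto)
qed

lemma psd_imp_sympsd:
  assumes "psd n A"
  shows "sympsd n (\<lambda>p r. A $$ (p, r))"
  unfolding sympsd_def
proof (intro conjI allI impI)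
  fix i j assume "i < n" "j < n"
  then have "transpose_mat A $$ (i, j) = A $$ (j, i)"
    using assms by (intro index_transpose_mat(1)) (auto simp: psd_def)
  then show "A $$ (i, j) = A $$ (j, i)" using assms by (simp add: psd_def)
next
  fix x
  have "0 \<le> scalar_prod (vec n x) (A *\<^sub>v vec n x)" using assms by (auto simp: psd_def)
  also have "scalar_prod (vec n x) (A *\<^sub>v vec n x) = qform n (\<lambda>p r. A $$ (p, r)) x"
    using assms by (auto simp: psd_def qform_def scalar_prod_def atLeast0LessThan sum_distrib_left
        mult.assoc intro!: sum.cong)
  finally show "0 \<le> qform n (\<lambda>p r. A $$ (p, r)) x" .
qed

text \<open>From n = 2 on the base is at most \<open>n ^ 3\<close>. This exponent and the three
  digits per block give 9, and the division by \<open>ln 2\<close> changes the base of the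
  logarithm.\<close>

lemma log_base_bigo: "(\<lambda>n. 3 * real n * log 2 (real (cost_base n))) \<in> O(\<lambda>n. real n * ln (real n))"
proof (rule bigoI[where c = "9 / ln 2"], rule eventually_sequentiallyI[of 2])
  fix n :: nat assume n: "2 \<le> n"
  have "cost_base n \<le> n ^ 3"
  proof -
    have "n * n + 1 \<le> n * n + n * n" using n by (cases n) auto
    also have "\<dots> = 2 * (n * n)" by simp
    also have "\<dots> \<le> n * (n * n)" using n by (rule mult_le_mono1)
    finally show ?thesis by (simp add: cost_base_def power3_eq_cube mult.assoc)
  qed
  then have "real (cost_base n) \<le> real n ^ 3" by (metis of_nat_le_iff of_nat_power)
  then have "log 2 (real (cost_base n)) \<le> log 2 (real n ^ 3)" using n base_pos[of n] by simp
  also have "\<dots> = 3 * (ln (real n) / ln 2)" using n by (simp add: log_def ln_realpow)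
  finally have "3 * real n * log 2 (real (cost_base n)) \<le> 3 * real n * (3 * (ln (real n) / ln 2))"
    by (rule mult_left_mono) simp
  moreover have "1 \<le> real (cost_base n)" by (simp add: cost_base_def)
  then have "0 \<le> log 2 (real (cost_base n))" by simp
  moreover have "0 \<le> ln (real n)" using n by simp
  ultimately show "norm (3 * real n * log 2 (real (cost_base n))) \<le> 9 / ln 2 * norm (real n * ln (real n))"
    by (simp add: abs_mult)
qed

theorem lemma4p1:
  shows "\<exists>(P :: com) (f :: nat \<Rightarrow> real).
    poly_time P {(n, A). 1 \<le> n \<and> (\<forall>i<n. psd n (A i))} \<and>
    f \<in> O(\<lambda>n. real n * ln (real n)) \<and>
    (\<forall>(n::nat) (A :: nat \<Rightarrow> real mat). 1 \<le> n \<and> (\<forall>i<n. psd n (A i)) \<longrightarrow>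
      (\<exists>(m::nat) (L :: real mat) (c :: int vec) (C :: int) (\<alpha> :: real).
        computes P n A m L c C \<alpha> \<and>
        psd m L \<and>
        \<alpha> \<noteq> 0 \<and>
        \<alpha> * mixed_discriminant n A = (\<Sum>S\<in>{S. S \<subseteq> {..<m} \<and> cost c S = C}. dpp_weight L S) \<and>
        real_of_int (l1_norm c) \<le> 2 powr f n))"
proof (intro exI[of _ reduction] exI[of _ "\<lambda>n. 3 * real n * log 2 (real (cost_base n))"] conjI allI impI)
  show "poly_time reduction {(n, A). 1 \<le> n \<and> (\<forall>i<n. psd n (A i))}"
    by (rule poly_time_reduction)
  show "(\<lambda>n. 3 * real n * log 2 (real (cost_base n))) \<in> O(\<lambda>n. real n * ln (real n))"
    by (rule log_base_bigo)
next
  fix n :: nat and A :: "nat \<Rightarrow> real mat"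
  assume nA: "1 \<le> n \<and> (\<forall>i<n. psd n (A i))"
  then interpret bounded_run "\<lambda>_. 0" 0 n A by unfold_locales auto
  let ?L = "kernel_mat n (pivot_weight A) (pivot_column A)"
  have "computes reduction n A (2 * n * n) ?L (cost_vec n) (int (target_cost n)) 1"
    using run_reduction unfolding computes_def by blast
  moreover have "psd (2 * n * n) ?L"
  proof (rule psd_kernel_mat)
    fix i k assume "i < n" "k < n"
    then have "0 \<le> pivoted A i k k k"
      unfolding pivoted_def using nA by (intro sympsd_diag_nonneg[OF sympsd_schur[OF psd_imp_sympsd]]) auto
    then show "0 \<le> pivot_weight A i k" by (simp add: pivot_weight_def)
  qed
  \<comment> \<open>Both sides are the same sum over the choices \<open>\<kappa>\<close>, term by
    term, so no scaling is required.\<close>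
  moreover have "1 * mixed_discriminant n A =
    (\<Sum>S\<in>{S. S \<subseteq> {..<2 * n * n} \<and> cost (cost_vec n) S = int (target_cost n)}. dpp_weight ?L S)"
  proof -
    have "A i $$ (p, q) = (\<Sum>k<n. pivot_weight A i k * pivot_column A i k p * pivot_column A i k q)"
      if "i < n" "p < n" "q < n" for i p q
      using schur_decomposition[OF psd_imp_sympsd that(2,3), of "A i"] nA that(1)
      by (simp add: pivot_weight_def pivot_column_def pivoted_def)
    from mixed_discriminant_rank_one_sums[OF this] show ?thesis
      using dpp_weights_target_cost nA by simp
  qed
  \<comment> \<open>The exponent is the binary logarithm of \<open>cost_base n ^ (3 * n)\<close>,
    the bound on the total cost.\<close>
  moreover have "real_of_int (l1_norm (cost_vec n)) \<le> 2 powr (3 * real n * log 2 (real (cost_base n)))"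
  proof -
    have "real_of_int (l1_norm (cost_vec n)) \<le> real_of_int (int ((cost_base n ^ 3) ^ n))"
      using l1_norm_cost_vec[of n] by (simp only: of_int_le_iff)
    also have "\<dots> = real (cost_base n) ^ (3 * n)" by (simp add: power_mult)
    also have "\<dots> = (2 powr log 2 (real (cost_base n))) powr real (3 * n)"
      using base_pos[of n] powr_realpow[OF base_pos, of n "3 * n"] by simp
    also have "\<dots> = 2 powr (3 * real n * log 2 (real (cost_base n)))"
      by (simp add: powr_powr mult.commute)
    finally show ?thesis .
  qed
  ultimately show "\<exists>m L c C \<alpha>. computes reduction n A m L c C \<alpha> \<and> psd m L \<and> \<alpha> \<noteq> 0 \<and>
      \<alpha> * mixed_discriminant n A = (\<Sum>S\<in>{S. S \<subseteq> {..<m} \<and> cost c S = C}. dpp_weight L S) \<and>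
      real_of_int (l1_norm c) \<le> 2 powr (3 * real n * log 2 (real (cost_base n)))"
    by (intro exI[of _ "2 * n * n"] exI[of _ ?L] exI[of _ "cost_vec n"]
        exI[of _ "int (target_cost n)"] exI[of _ "1::real"]) auto
qed

end
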